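(* Let $(\Omega,d,\mu)$ be a metric probability space (a connected separable metric space equipped with a non-atomic Borel probability measure $\mu$) whose isoperimetric profile $I=I_{(\Omega,d,\mu)}$ is continuous on $[0,1]$, positive on $(0,1)$, and satisfies $I(0)=0$. Let $1\le q<\infty$. Then for every $f\in Lip(\Omega)\cap L^1(\Omega)$ and every $t\in(0,1)$, $$\big(f_\mu^{\ast\ast}(t)-f_\mu^{\ast}(t)\big)\,w_q(t)\le\Big(\frac1t\int_0^t\big(|\nabla f|_\mu^{\ast}(s)\big)^q ds\Big)^{1/q}.$$
   Context: $Lip(\Omega)$ is the set of real-valued Lipschitz functions on $\Omega$. For $f\in Lip(\Omega)$, $|\nabla f(x)|=\limsup_{d(x,y)\to0}\frac{|f(x)-f(y)|}{d(x,y)}$. For a Borel set $A\subset\Omega$, the Minkowski content is $\mu^+(A)=\liminf_{h\to0}\frac{\mu(A_h)-\mu(A)}{h}$, where $A_h=\{x\in\Omega: d(x,A)<h\}$. The isoperimetric profile $I=I_{(\Omega,d,\mu)}:[0,1]\to[0,\infty)$ is the pointwise maximal function such that $\mu^+(A)\ge I(\mu(A))$ for all Borel sets $A$. For measurable $u:\Omega\to\mathbb{R}$: $\mu_u(t)=\mu\{x:|u(x)|>t\}$; the decreasing rearrangement is $u_\mu^{\ast}(s)=\inf\{t\ge0:\mu_u(t)\le s\}$ for $s\in(0,1)$; and $u_\mu^{\ast\ast}(t)=\frac1t\int_0^t u_\mu^{\ast}(s)\,ds$. The function $w_q$ is defined, for $t\in(0,1)$, by $$w_q(t)=\Big(\frac1t\int_0^t\Big(\frac{s}{I(s)}\Big)^{\frac{q}{q-1}}ds\Big)^{\frac{1-q}{q}}\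 \text{ if } q>1,\qquad w_1(t)=\inf_{0<s<t}\frac{I(s)}{s},$$ with the convention $w_q(t)=0$ if the integral is infinite. *)

theory Defs
  imports "HOL-Probability.Probability"
begin

text \<open>The underlying space \<open>\<Omega>\<close> is the whole type.\<close>

locale metric_probability_space = prob_space M
  for M :: "'a::metric_space measure" +
  assumes sets_eq_borel: "sets M = sets borel"
    and connected_space: "connected (UNIV :: 'a set)"
    and separable: "separable_space (euclidean :: 'a topology)"
    and nonatomic: "\<And>A. A \<in> sets M \<Longrightarrow> measure M A > 0 \<Longrightarrow>
          \<exists>B\<in>sets M. B \<subseteq> A \<and> 0 < measure M B \<and> measure M B < measure M A"

definition Lip :: "('a::metric_space \<Rightarrow> real) set" where
  "Lip = {f. \<exists>L. L-lipschitz_on UNIV f}"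

text \<open>The upper limit is taken in \<open>ereal\<close>, where it always exists; for Lipschitz functions on a space
  without isolated points it lies in \<open>[0, \<infinity>)\<close>, so the conversion back to \<open>real\<close> is harmless.\<close>

definition grad_norm :: "('a::metric_space \<Rightarrow> real) \<Rightarrow> 'a \<Rightarrow> real" where
  "grad_norm f x = real_of_ereal (Limsup (at x) (\<lambda>y. ereal (\<bar>f x - f y\<bar> / dist x y)))"

text \<open>The library sets \<open>infdist x {} = 0\<close>, whereas the distance to the empty set has to be \<open>\<infinity>\<close> here.\<close>

definition enlargement :: "'a::metric_space set \<Rightarrow> real \<Rightarrow> 'a set" where
  "enlargement A h = {x. A \<noteq> {} \<and> infdist x A < h}"

definition minkowski_content :: "'a::metric_space measure \<Rightarrow> 'a set \<Rightarrow> ereal" where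
  "minkowski_content M A =
     Liminf (at_right 0) (\<lambda>h. ereal ((measure M (enlargement A h) - measure M A) / h))"

definition isoperimetric_minorant :: "'a::metric_space measure \<Rightarrow> (real \<Rightarrow> real) \<Rightarrow> bool" where
  "isoperimetric_minorant M J \<longleftrightarrow>
     (\<forall>s\<in>{0..1}. 0 \<le> J s) \<and>
     (\<forall>A\<in>sets borel. ereal (J (measure M A)) \<le> minkowski_content M A)"

text \<open>This determines \<open>I\<close> uniquely on \<open>[0, 1]\<close>; the values of \<open>I\<close> outside \<open>[0, 1]\<close> are irrelevant.\<close>

definition is_isoperimetric_profile :: "'a::metric_space measure \<Rightarrow> (real \<Rightarrow> real) \<Rightarrow> bool" where
  "is_isoperimetric_profile M I \<longleftrightarrow>
     isoperimetric_minorant M I \<and>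
     (\<forall>J. isoperimetric_minorant M J \<longrightarrow> (\<forall>s\<in>{0..1}. J s \<le> I s))"

definition distribution_fun :: "'a measure \<Rightarrow> ('a \<Rightarrow> real) \<Rightarrow> real \<Rightarrow> real" where
  "distribution_fun M u t = measure M {x \<in> space M. \<bar>u x\<bar> > t}"

definition decr_rearr :: "'a measure \<Rightarrow> ('a \<Rightarrow> real) \<Rightarrow> real \<Rightarrow> real" where
  "decr_rearr M u s = Inf {t. 0 \<le> t \<and> distribution_fun M u t \<le> s}"

definition max_rearr :: "'a measure \<Rightarrow> ('a \<Rightarrow> real) \<Rightarrow> real \<Rightarrow> real" where
  "max_rearr M u t = 1 / t * (LINT s:{0<..<t}|lborel. decr_rearr M u s)"

text \<open>For \<open>q > 1\<close> the integral is formed in \<open>[0, \<infinity>]\<close>, so that divergence can be tested for.\<close>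

definition w_fun :: "(real \<Rightarrow> real) \<Rightarrow> real \<Rightarrow> real \<Rightarrow> real" where
  "w_fun I q t =
     (if q = 1 then (INF s\<in>{0<..<t}. I s / s)
      else (let J = (\<integral>\<^sup>+ s\<in>{0<..<t}. ennreal ((s / I s) powr (q / (q - 1))) \<partial>lborel)
            in if J = \<infinity> then 0 else (1 / t * enn2real J) powr ((1 - q) / q)))"

end

theory Submission
  imports Defs
begin

text \<open>
Write \<open>\<mu>\<^sub>f\<close> for the distribution function of \<open>f\<close>, \<open>c\<close> for \<open>f\<^sup>*(t)\<close>, and \<open>g\<close> for \<open>|\<nabla>f|\<close>. Integrating
\<open>f\<^sup>* - c\<close> over \<open>(0, t)\<close> and slicing horizontally turns the oscillation into an integral over levels,
\<open>t (f\<^sup>*\<^sup>*(t) - f\<^sup>*(t)) = \<integral>\<^sub>c\<^sup>\<infinity> \<mu>\<^sub>f(\<lambda>) d\<lambda>\<close> (\<open>max_rearr_minus_decr_rearr\<close>), and for \<open>\<lambda> \<ge> c\<close> the level set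
\<open>{|f| > \<lambda>}\<close> has measure at most \<open>t\<close>.

The isoperimetric inequality enters through a coarea inequality,
\<open>\<integral> \<phi>(\<lambda>) I(\<mu>\<^sub>f(\<lambda>)) d\<lambda> \<le> \<integral> \<phi>(|f|) g d\<mu>\<close>, for every Borel weight \<open>\<phi> \<ge> 0\<close>
(\<open>coarea_distribution_fun_le\<close>). It is obtained by
applying the isoperimetric inequality to every level set: the \<open>h\<close>-enlargement of a superlevel set of \<open>f\<close> is
the superlevel set of the supremum of \<open>f\<close> over balls of radius \<open>h\<close>, that supremum exceeds \<open>f\<close> by at most \<open>h\<close>
times the largest difference quotient at scale \<open>h\<close>, and this quotient decreases to \<open>g\<close> as \<open>h\<close>
tends to \<open>0\<close>. Fatou's lemma on the side of the levels and monotone convergence on the side of the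
space give the case where \<open>\<phi>\<close> is the indicator of a closed set; inner regularity gives all Borel weights.

For \<open>q = 1\<close> one has \<open>w\<^sub>1(t) \<mu>\<^sub>f(\<lambda>) \<le> I(\<mu>\<^sub>f(\<lambda>))\<close> for \<open>\<lambda> \<ge> c\<close>, so the weight \<open>\<phi> = 1\<close> on \<open>(c, \<infinity>)\<close> bounds the
oscillation by the integral of \<open>g\<close> over \<open>{|f| > c}\<close>, a set of measure at most \<open>t\<close>; such an integral is
at most that of \<open>g\<^sup>*\<close> over \<open>(0, t)\<close>.

For \<open>q > 1\<close> the weight is \<open>\<phi>(\<lambda>) = \<mu>\<^sub>f(\<lambda>) / I(\<mu>\<^sub>f(\<lambda>))\<close> on \<open>(c, \<infinity>)\<close>, set to \<open>0\<close> at the levels that \<open>|f|\<close> takes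
with positive probability. There are countably many such levels, so the integral over the levels does
not change. Hoelder's inequality on the space separates \<open>\<phi>(|f|)\<close> from \<open>g\<close>. Away from the removed levels
\<open>\<mu>\<^sub>f(f\<^sup>*(s)) = s\<close>, so that, \<open>|f|\<close> and \<open>f\<^sup>*\<close> being equidistributed, the \<open>p\<close>-th power of \<open>\<phi>(|f|)\<close>
integrates to at most \<open>\<integral>\<^sub>0\<^sup>t (s / I(s))\<^sup>p ds\<close>, where \<open>p = q / (q - 1)\<close>. Removing the levels of
positive mass is essential: \<open>s / I(s)\<close> need not be monotone, and at such a level its value
is not controlled by its average over the corresponding jump of \<open>\<mu>\<^sub>f\<close>.
\<close>

section \<open>Decreasing rearrangements\<close>

lemma (in prob_space) distribution_fun_eq_cdf:
  assumes [measurable]: "u \<in> borel_measurable M"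
  shows "distribution_fun M u l = 1 - cdf (distr M borel (\<lambda>x. \<bar>u x\<bar>)) l"
proof -
  have "cdf (distr M borel (\<lambda>x. \<bar>u x\<bar>)) l = prob {x \<in> space M. \<bar>u x\<bar> \<le> l}"
    unfolding cdf_def by (subst measure_distr) (auto intro!: arg_cong[where f=prob])
  moreover have "distribution_fun M u l = 1 - prob {x \<in> space M. \<bar>u x\<bar> \<le> l}"
    unfolding distribution_fun_def
    by (subst prob_compl[symmetric]) (auto intro!: arg_cong[where f=prob])
  ultimately show ?thesis by simp
qed

lemma (in prob_space) distribution_fun_antimono:
  assumes "u \<in> borel_measurable M" "l \<le> l'"
  shows "distribution_fun M u l' \<le> distribution_fun M u l"
  unfolding distribution_fun_def using assms by (intro finite_measure_mono) auto

lemma (in prob_space) distribution_fun_bounds: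
  "0 \<le> distribution_fun M u l" "distribution_fun M u l \<le> 1"
  unfolding distribution_fun_def by auto

lemma (in prob_space) borel_measurable_distribution_fun:
  assumes "u \<in> borel_measurable M"
  shows "distribution_fun M u \<in> borel_measurable borel"
proof -
  have "mono (\<lambda>l. - distribution_fun M u l)"
    using distribution_fun_antimono[OF assms] by (auto simp: mono_def)
  from borel_measurable_mono[OF this] have "(\<lambda>l. - (- distribution_fun M u l)) \<in> borel_measurable borel"
    by (rule borel_measurable_uminus)
  then show ?thesis by simp
qed

text \<open>The distribution function is right-continuous, so the infimum defining the rearrangement is attained.
  The resulting Galois connection turns statements about \<open>u\<^sup>*\<close> into statements about measures of level sets.\<close>

lemma (in prob_space) less_decr_rearr_iff:
  assumes u: "u \<in> borel_measurable M" and s: "0 < s" and l: "0 \<le> l"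
  shows "l < decr_rearr M u s \<longleftrightarrow> s < distribution_fun M u l"
proof -
  interpret D: real_distribution "distr M borel (\<lambda>x. \<bar>u x\<bar>)"
    using u by (intro real_distribution_distr) auto
  let ?S = "{r. 0 \<le> r \<and> distribution_fun M u r \<le> s}"
  have bdd: "bdd_below ?S" by (rule bdd_belowI[of _ 0]) auto
  have "((\<lambda>r. distribution_fun M u r) \<longlongrightarrow> 1 - 1) at_top"
    unfolding distribution_fun_eq_cdf[OF u] by (intro tendsto_intros D.cdf_lim_at_top_prob)
  then have "eventually (\<lambda>r. distribution_fun M u r < s) at_top"
    using s by (intro order_tendstoD) auto
  moreover have "eventually (\<lambda>r. 0 \<le> r) (at_top :: real filter)" by (rule eventually_ge_at_top)
  ultimately have "eventually (\<lambda>r. r \<in> ?S) at_top" by eventually_elim auto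
  then have ne: "?S \<noteq> {}" using eventually_happens'[of "at_top :: real filter"] by fastforce
  show ?thesis
  proof
    assume *: "l < decr_rearr M u s"
    show "s < distribution_fun M u l"
    proof (rule ccontr)
      assume "\<not> s < distribution_fun M u l"
      then have "Inf ?S \<le> l" using l bdd by (intro cInf_lower) auto
      with * show False by (simp add: decr_rearr_def)
    qed
  next
    assume *: "s < distribution_fun M u l"
    have "((\<lambda>r. distribution_fun M u r) \<longlongrightarrow> distribution_fun M u l) (at_right l)"
      using D.cdf_is_right_cont[of l] unfolding distribution_fun_eq_cdf[OF u] continuous_within
      by (intro tendsto_intros)
    then have "eventually (\<lambda>r. s < distribution_fun M u r) (at_right l)"
      using * by (rule order_tendstoD)
    then obtain b where b: "l < b" "\<And>r. l < r \<Longrightarrow> r < b \<Longrightarrow> s < distribution_fun M u r"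
      unfolding eventually_at_right_field by auto
    define r where "r = (l + b) / 2"
    have r: "l < r" "s < distribution_fun M u r" using b by (auto simp: r_def)
    have "r \<le> Inf ?S"
    proof (rule cInf_greatest[OF ne])
      fix y assume "y \<in> ?S"
      then show "r \<le> y" using distribution_fun_antimono[OF u, of y r] r by fastforce
    qed
    with r show "l < decr_rearr M u s" by (simp add: decr_rearr_def)
  qed
qed

lemma (in prob_space) decr_rearr_nonneg:
  assumes u: "u \<in> borel_measurable M" and s: "0 < s"
  shows "0 \<le> decr_rearr M u s"
proof (rule ccontr)
  assume "\<not> 0 \<le> decr_rearr M u s"
  then have neg: "decr_rearr M u s < 0" by simp
  then have "\<not> s < distribution_fun M u 0"
    using less_decr_rearr_iff[OF u s, of 0] by simp
  then have "{r. 0 \<le> r \<and> distribution_fun M u r \<le> s} \<noteq> {}" by force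
  then have "0 \<le> decr_rearr M u s"
    unfolding decr_rearr_def by (intro cInf_greatest) auto
  with neg show False by simp
qed

lemma (in prob_space) decr_rearr_antimono:
  assumes u: "u \<in> borel_measurable M" and s: "0 < s" "s \<le> s'"
  shows "decr_rearr M u s' \<le> decr_rearr M u s"
proof (rule ccontr)
  assume "\<not> ?thesis"
  then show False
    using less_decr_rearr_iff[OF u, of s' "decr_rearr M u s"]
      less_decr_rearr_iff[OF u, of s "decr_rearr M u s"] s decr_rearr_nonneg[OF u, of s] by simp
qed

lemma (in prob_space) distribution_fun_decr_rearr_le:
  assumes u: "u \<in> borel_measurable M" and s: "0 < s"
  shows "distribution_fun M u (decr_rearr M u s) \<le> s"
  using less_decr_rearr_iff[OF u s decr_rearr_nonneg[OF u s]] by simp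

abbreviation unit_lborel :: "real measure" where
  "unit_lborel \<equiv> restrict_space lborel {0<..<1}"

lemma prob_space_unit_lborel: "prob_space unit_lborel"
  by (auto simp: emeasure_restrict_space space_restrict_space intro!: prob_spaceI)

lemma (in prob_space) sets_decr_rearr_greater:
  assumes u: "u \<in> borel_measurable M" 
  shows "{s \<in> {0<..<1}. l < decr_rearr M u s} 
    = (if l < 0 then {0<..<1} else {0<..<distribution_fun M u l})"
  using less_decr_rearr_iff[OF u, of _ l] decr_rearr_nonneg[OF u] distribution_fun_bounds(2)[of u l]
  by (auto) (smt (verit))+

lemma (in prob_space) borel_measurable_decr_rearr:
  assumes u: "u \<in> borel_measurable M" 
  shows "decr_rearr M u \<in> borel_measurable unit_lborel"
proof (rule borel_measurableI_greater)
  fix l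
  have "{s \<in> space unit_lborel. l < decr_rearr M u s} = {s \<in> {0<..<1}. l < decr_rearr M u s} \<inter> {0<..<1}"
    by (auto simp: space_restrict_space)
  also have "\<dots> \<in> sets unit_lborel"
    unfolding sets_decr_rearr_greater[OF u] sets_restrict_space by (auto intro!: imageI)
  finally show "{s \<in> space unit_lborel. l < decr_rearr M u s} \<in> sets unit_lborel" .
qed

text \<open>On \<open>(0, 1)\<close> the rearrangement exceeds a level \<open>l \<ge> 0\<close> exactly on \<open>(0, \<mu>\<^sub>u(l))\<close>, so it has the distribution
  function of \<open>|u|\<close>.\<close>

lemma (in prob_space) distr_decr_rearr:
  assumes u: "u \<in> borel_measurable M" 
  shows "distr unit_lborel borel (decr_rearr M u) = distr M borel (\<lambda>x. \<bar>u x\<bar>)"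
proof (rule cdf_unique)
  interpret U: prob_space unit_lborel by (rule prob_space_unit_lborel)
  note m = borel_measurable_decr_rearr[OF u]
  have ma: "(\<lambda>x. \<bar>u x\<bar>) \<in> borel_measurable M" using u by simp
  show "real_distribution (distr unit_lborel borel (decr_rearr M u))"
    using m by (rule U.real_distribution_distr)
  show "real_distribution (distr M borel (\<lambda>x. \<bar>u x\<bar>))"
    using ma by (rule real_distribution_distr)
  show "cdf (distr unit_lborel borel (decr_rearr M u)) = cdf (distr M borel (\<lambda>x. \<bar>u x\<bar>))"
  proof
    fix l
    have "cdf (distr unit_lborel borel (decr_rearr M u)) l
        = measure unit_lborel (space unit_lborel - {s \<in> {0<..<1}. l < decr_rearr M u s})"
      unfolding cdf_def using m
      by (subst measure_distr) (auto intro!: arg_cong[where f="measure unit_lborel"] simp: space_restrict_space)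
    also have "\<dots> = 1 - measure unit_lborel {s \<in> {0<..<1}. l < decr_rearr M u s}"
      using m borel_measurable_iff_greater[of "decr_rearr M u" unit_lborel]
      by (intro U.prob_compl) (auto simp: space_restrict_space)
    also have "measure unit_lborel {s \<in> {0<..<1}. l < decr_rearr M u s} = distribution_fun M u l"
    proof (cases "l < 0")
      case True
      then have "{x \<in> space M. l < \<bar>u x\<bar>} = space M" by auto
      then show ?thesis using True unfolding sets_decr_rearr_greater[OF u]
        by (simp add: measure_restrict_space distribution_fun_def prob_space)
    next
      case False
      then show ?thesis using distribution_fun_bounds[of u l] unfolding sets_decr_rearr_greater[OF u]
        by (subst measure_restrict_space) auto
    qed
    also have "1 - distribution_fun M u l = cdf (distr M borel (\<lambda>x. \<bar>u x\<bar>)) l"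
      by (simp add: distribution_fun_eq_cdf[OF u])
    finally show "cdf (distr unit_lborel borel (decr_rearr M u)) l = cdf (distr M borel (\<lambda>x. \<bar>u x\<bar>)) l" .
  qed
qed

lemma (in prob_space) nn_integral_decr_rearr:
  assumes u: "u \<in> borel_measurable M" and [measurable]: "h \<in> borel_measurable borel"
  shows "(\<integral>\<^sup>+ s. h (decr_rearr M u s) \<partial>unit_lborel) = (\<integral>\<^sup>+ x. h \<bar>u x\<bar> \<partial>M)"
proof -
  have ma: "(\<lambda>x. \<bar>u x\<bar>) \<in> borel_measurable M" using u by simp
  have "(\<integral>\<^sup>+ s. h (decr_rearr M u s) \<partial>unit_lborel)
      = integral\<^sup>N (distr unit_lborel borel (decr_rearr M u)) h"
    using borel_measurable_decr_rearr[OF u] by (subst nn_integral_distr) auto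
  also have "\<dots> = (\<integral>\<^sup>+ x. h \<bar>u x\<bar> \<partial>M)"
    using ma unfolding distr_decr_rearr[OF u] by (subst nn_integral_distr) auto
  finally show ?thesis .
qed

lemma (in prob_space) borel_measurable_decr_rearr_restricted:
  assumes u: "u \<in> borel_measurable M" and [measurable]: "h \<in> borel_measurable borel" and t: "t \<le> 1"
  shows "(\<lambda>s. h (decr_rearr M u s) * indicator {0<..<t} s :: ennreal) \<in> borel_measurable lborel"
proof -
  have "(\<lambda>s. h (decr_rearr M u s)) \<in> borel_measurable unit_lborel"
    using borel_measurable_decr_rearr[OF u] by measurable
  then have "(\<lambda>s. h (decr_rearr M u s) * indicator {0<..<1} s) \<in> borel_measurable lborel"
    by (subst (asm) borel_measurable_restrict_space_iff_ennreal) auto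
  then have "(\<lambda>s. h (decr_rearr M u s) * indicator {0<..<1} s * indicator {0<..<t} s) \<in> borel_measurable lborel"
    by measurable
  also have "(\<lambda>s. h (decr_rearr M u s) * indicator {0<..<1} s * indicator {0<..<t} s)
    = (\<lambda>s. h (decr_rearr M u s) * indicator {0<..<t} s)"
    using t by (auto simp: fun_eq_iff split: split_indicator)
  finally show ?thesis .
qed

text \<open>Since \<open>u\<^sup>*\<close> is decreasing, a function vanishing below \<open>u\<^sup>*(t)\<close> only sees the part \<open>(0, t)\<close> of the interval.
  This localises equidistribution without choosing a subset of the space of measure exactly \<open>t\<close>.\<close>

lemma (in prob_space) nn_integral_decr_rearr_truncated:
  assumes u: "u \<in> borel_measurable M" and [measurable]: "h \<in> borel_measurable borel" 
    and t: "0 < t" "t < 1"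
    and zero: "\<And>l. l \<le> decr_rearr M u t \<Longrightarrow> 0 \<le> l \<Longrightarrow> h l = (0::ennreal)"
  shows "(\<integral>\<^sup>+ s\<in>{0<..<t}. h (decr_rearr M u s) \<partial>lborel) = (\<integral>\<^sup>+ x. h \<bar>u x\<bar> \<partial>M)"
proof -
  have "(\<integral>\<^sup>+ s\<in>{0<..<t}. h (decr_rearr M u s) \<partial>lborel) = (\<integral>\<^sup>+ s\<in>{0<..<1}. h (decr_rearr M u s) \<partial>lborel)"
    using t zero decr_rearr_antimono[OF u t(1)] decr_rearr_nonneg[OF u]
    by (intro nn_integral_cong) (auto split: split_indicator)
  also have "\<dots> = (\<integral>\<^sup>+ s. h (decr_rearr M u s) \<partial>unit_lborel)"
    by (subst nn_integral_restrict_space) auto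
  finally show ?thesis by (simp add: nn_integral_decr_rearr[OF u])
qed

text \<open>With \<open>c = u\<^sup>*(t)\<close>, the excess of \<open>h(|u|)\<close> over \<open>h(c)\<close> integrates over the whole space to the excess of
  \<open>h(u\<^sup>*)\<close> over \<open>(0, t)\<close>, and the constant \<open>h(c)\<close> contributes at most \<open>h(c) t\<close> on the left, exactly that on the right.\<close>

lemma (in prob_space) nn_integral_set_le_decr_rearr:
  assumes u: "u \<in> borel_measurable M" and h[measurable]: "h \<in> borel_measurable borel"
    and mono: "\<And>a b. 0 \<le> a \<Longrightarrow> a \<le> b \<Longrightarrow> h a \<le> h b" and fin: "\<And>a. h a < (top::ennreal)"
    and E[measurable]: "E \<in> sets M" and t: "prob E \<le> t" "0 < t" "t < 1"
  shows "(\<integral>\<^sup>+ x\<in>E. h \<bar>u x\<bar> \<partial>M) \<le> (\<integral>\<^sup>+ s\<in>{0<..<t}. h (decr_rearr M u s) \<partial>lborel)"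
proof -
  define c where "c = decr_rearr M u t"
  define k where "k l = h l - h c" for l
  note [measurable] = u
  have [measurable]: "k \<in> borel_measurable borel" unfolding k_def by measurable
  have c0: "0 \<le> c" using decr_rearr_nonneg[OF u t(2)] by (simp add: c_def)
  have "(\<integral>\<^sup>+ x\<in>E. h \<bar>u x\<bar> \<partial>M) \<le> (\<integral>\<^sup>+ x. k \<bar>u x\<bar> + h c * indicator E x \<partial>M)"
  proof (intro nn_integral_mono)
    fix x show "h \<bar>u x\<bar> * indicator E x \<le> k \<bar>u x\<bar> + h c * indicator E x"
      by (cases "h c \<le> h \<bar>u x\<bar>")
        (auto simp: k_def diff_add_cancel_ennreal not_le intro: add_increasing split: split_indicator)
  qed
  also have "\<dots> = (\<integral>\<^sup>+ x. k \<bar>u x\<bar> \<partial>M) + h c * emeasure M E"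
    by (subst nn_integral_add) (auto simp: nn_integral_cmult_indicator)
  also have "\<dots> \<le> (\<integral>\<^sup>+ x. k \<bar>u x\<bar> \<partial>M) + h c * ennreal t"
    using t by (intro add_left_mono mult_left_mono) (auto simp: emeasure_eq_measure)
  also have "(\<integral>\<^sup>+ x. k \<bar>u x\<bar> \<partial>M) = (\<integral>\<^sup>+ s\<in>{0<..<t}. k (decr_rearr M u s) \<partial>lborel)"
    using t mono by (intro nn_integral_decr_rearr_truncated[symmetric] u)
      (auto simp: k_def c_def[symmetric] diff_eq_0_iff_ennreal fin)
  also have "h c * ennreal t = (\<integral>\<^sup>+ s. h c * indicator {0<..<t} s \<partial>lborel)"
    using t by (simp add: nn_integral_cmult_indicator)
  also have "(\<integral>\<^sup>+ s\<in>{0<..<t}. k (decr_rearr M u s) \<partial>lborel) + (\<integral>\<^sup>+ s. h c * indicator {0<..<t} s \<partial>lborel)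
    = (\<integral>\<^sup>+ s. k (decr_rearr M u s) * indicator {0<..<t} s + h c * indicator {0<..<t} s \<partial>lborel)"
    using borel_measurable_decr_rearr_restricted[OF u, of k t] t by (subst nn_integral_add) auto
  also have "\<dots> = (\<integral>\<^sup>+ s\<in>{0<..<t}. h (decr_rearr M u s) \<partial>lborel)"
  proof (intro nn_integral_cong)
    fix s
    show "k (decr_rearr M u s) * indicator {0<..<t} s + h c * indicator {0<..<t} s
      = h (decr_rearr M u s) * indicator {0<..<t} s"
      using decr_rearr_antimono[OF u, of s t] mono[OF c0] 
      by (auto simp: k_def c_def[symmetric] diff_add_cancel_ennreal split: split_indicator)
  qed
  finally show ?thesis .
qed

text \<open>Tonelli's theorem for the region between the level \<open>c\<close> and the graph of \<open>|u|\<close>.\<close>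

lemma (in prob_space) nn_integral_excess_eq_distribution_fun:
  assumes u[measurable]: "u \<in> borel_measurable M"
  shows "(\<integral>\<^sup>+ x. ennreal (\<bar>u x\<bar> - c) \<partial>M) = (\<integral>\<^sup>+ l\<in>{c<..}. ennreal (distribution_fun M u l) \<partial>lborel)"
proof -
  interpret P: pair_sigma_finite lborel M by standard
  have "(\<integral>\<^sup>+ x. ennreal (\<bar>u x\<bar> - c) \<partial>M) = (\<integral>\<^sup>+ x. (\<integral>\<^sup>+ l. indicator {(l, x). c < l \<and> l < \<bar>u x\<bar>} (l, x) \<partial>lborel) \<partial>M)"
  proof (intro nn_integral_cong)
    fix x
    have "(\<integral>\<^sup>+ l. indicator {(l, x). c < l \<and> l < \<bar>u x\<bar>} (l, x) \<partial>lborel) = (\<integral>\<^sup>+ l. indicator {c<..<\<bar>u x\<bar>} l \<partial>lborel)"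
      by (intro nn_integral_cong) (auto split: split_indicator)
    then show "ennreal (\<bar>u x\<bar> - c) = (\<integral>\<^sup>+ l. indicator {(l, x). c < l \<and> l < \<bar>u x\<bar>} (l, x) \<partial>lborel)"
      by (cases "c \<le> \<bar>u x\<bar>") (auto simp: ennreal_neg)
  qed
  also have "\<dots> = (\<integral>\<^sup>+ l. (\<integral>\<^sup>+ x. indicator {(l, x). c < l \<and> l < \<bar>u x\<bar>} (l, x) \<partial>M) \<partial>lborel)"
  proof (rule P.Fubini)
    have "{p \<in> space (lborel \<Otimes>\<^sub>M M). c < fst p \<and> fst p < \<bar>u (snd p)\<bar>} \<in> sets (lborel \<Otimes>\<^sub>M M)"
      by measurable
    then have "indicator {p \<in> space (lborel \<Otimes>\<^sub>M M). c < fst p \<and> fst p < \<bar>u (snd p)\<bar>}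
        \<in> borel_measurable (lborel \<Otimes>\<^sub>M M)" by (rule borel_measurable_indicator)
    then show "indicator {(l, x). c < l \<and> l < \<bar>u x\<bar>} \<in> borel_measurable (lborel \<Otimes>\<^sub>M M)"
      by (rule measurable_cong[THEN iffD1, rotated]) (auto split: split_indicator)
  qed
  also have "\<dots> = (\<integral>\<^sup>+ l\<in>{c<..}. ennreal (distribution_fun M u l) \<partial>lborel)"
  proof (intro nn_integral_cong)
    fix l
    have "(\<integral>\<^sup>+ x. indicator {(l, x). c < l \<and> l < \<bar>u x\<bar>} (l, x) \<partial>M)
       = (\<integral>\<^sup>+ x. indicator {c<..} l * indicator {x \<in> space M. l < \<bar>u x\<bar>} x \<partial>M)"
      by (intro nn_integral_cong) (auto split: split_indicator)
    also have "\<dots> = indicator {c<..} l * emeasure M {x \<in> space M. l < \<bar>u x\<bar>}"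
      by (subst nn_integral_cmult_indicator) auto
    finally show "(\<integral>\<^sup>+ x. indicator {(l, x). c < l \<and> l < \<bar>u x\<bar>} (l, x) \<partial>M)
       = ennreal (distribution_fun M u l) * indicator {c<..} l"
      by (simp add: distribution_fun_def emeasure_eq_measure mult.commute)
  qed
  finally show ?thesis .
qed

definition level_atoms :: "'a measure \<Rightarrow> ('a \<Rightarrow> real) \<Rightarrow> real set" where
  "level_atoms M u = {l. measure (distr M borel (\<lambda>x. \<bar>u x\<bar>)) {l} \<noteq> 0}"

lemma (in prob_space) countable_level_atoms:
  assumes u: "u \<in> borel_measurable M"
  shows "countable (level_atoms M u)"
proof -
  interpret D: real_distribution "distr M borel (\<lambda>x. \<bar>u x\<bar>)"
    using u by (intro real_distribution_distr) auto
  show ?thesis unfolding level_atoms_def by (rule D.countable_support)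
qed

text \<open>A level carrying no mass is a continuity point of the distribution function, and \<open>\<mu>\<^sub>u \<ge> s\<close> to the left of
  \<open>u\<^sup>*(s)\<close>.\<close>

lemma (in prob_space) distribution_fun_decr_rearr_eq:
  assumes u: "u \<in> borel_measurable M" and s: "0 < s" "s < 1"
    and cont: "decr_rearr M u s \<notin> level_atoms M u"
  shows "distribution_fun M u (decr_rearr M u s) = s"
proof (rule antisym)
  let ?c = "decr_rearr M u s"
  interpret D: real_distribution "distr M borel (\<lambda>x. \<bar>u x\<bar>)"
    using u by (intro real_distribution_distr) auto
  show "distribution_fun M u ?c \<le> s" by (rule distribution_fun_decr_rearr_le[OF u s(1)])
  have "isCont (cdf (distr M borel (\<lambda>x. \<bar>u x\<bar>))) ?c"
    using cont by (simp add: D.isCont_cdf level_atoms_def)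
  then have "isCont (distribution_fun M u) ?c"
    unfolding distribution_fun_eq_cdf[OF u, abs_def] by (intro continuous_intros)
  then have "(distribution_fun M u \<longlongrightarrow> distribution_fun M u ?c) (at_left ?c)"
    unfolding isCont_def by (rule filterlim_mono) (auto simp: at_le)
  moreover have "eventually (\<lambda>l. s \<le> distribution_fun M u l) (at_left ?c)"
    unfolding eventually_at_filter
  proof (intro always_eventually allI impI)
    fix l assume l: "l \<in> {..<?c}"
    show "s \<le> distribution_fun M u l"
    proof (cases "0 \<le> l")
      case True
      then show ?thesis using less_decr_rearr_iff[OF u s(1) True] l by simp
    next
      case False
      then have "{x \<in> space M. l < \<bar>u x\<bar>} = space M" by auto
      then show ?thesis using s by (simp add: distribution_fun_def prob_space)
    qed
  qed
  ultimately show "s \<le> distribution_fun M u ?c"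
    by (rule tendsto_lowerbound) simp
qed

text \<open>Transported to \<open>(0, 1)\<close>, the left side evaluates \<open>\<psi>\<close> at \<open>\<mu>\<^sub>u(u\<^sup>*(s)) = s\<close> off the levels of positive mass; at such
  a level \<open>\<psi>\<close> would be evaluated at one end of a jump of \<open>\<mu>\<^sub>u\<close> instead of being averaged over the jump.\<close>

lemma (in prob_space) nn_integral_distribution_fun_levels_le:
  assumes u: "u \<in> borel_measurable M" and t: "0 < t" "t < 1" and psi: "\<psi> \<in> borel_measurable borel"
  shows "(\<integral>\<^sup>+ x. \<psi> (distribution_fun M u \<bar>u x\<bar>) * indicator ({decr_rearr M u t<..} - level_atoms M u) \<bar>u x\<bar> \<partial>M)
    \<le> (\<integral>\<^sup>+ s\<in>{0<..<t}. \<psi> s \<partial>lborel)"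
proof -
  let ?h = "\<lambda>l. \<psi> (distribution_fun M u l) * indicator ({decr_rearr M u t<..} - level_atoms M u) l :: ennreal"
  have [measurable]: "level_atoms M u \<in> sets borel"
    using countable_level_atoms[OF u] by (rule sets.countable[rotated]) simp
  note [measurable] = psi borel_measurable_distribution_fun[OF u]
  have "?h \<in> borel_measurable borel" by measurable
  then have "(\<integral>\<^sup>+ x. ?h \<bar>u x\<bar> \<partial>M) = (\<integral>\<^sup>+ s\<in>{0<..<t}. ?h (decr_rearr M u s) \<partial>lborel)"
    using t by (intro nn_integral_decr_rearr_truncated[symmetric] u) auto
  also have "\<dots> \<le> (\<integral>\<^sup>+ s\<in>{0<..<t}. \<psi> s \<partial>lborel)"
    using t distribution_fun_decr_rearr_eq[OF u]
    by (intro nn_integral_mono) (auto split: split_indicator)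
  finally show ?thesis .
qed

lemma (in prob_space) max_rearr_minus_decr_rearr:
  assumes f: "integrable M f" and t: "0 < t" "t < 1"
  shows "ennreal (t * (max_rearr M f t - decr_rearr M f t))
    = (\<integral>\<^sup>+ l\<in>{decr_rearr M f t<..}. ennreal (distribution_fun M f l) \<partial>lborel)"
proof -
  have u[measurable]: "f \<in> borel_measurable M" using f by auto
  define c where "c = decr_rearr M f t"
  let ?g = "\<lambda>s. indicator {0<..<t} s *\<^sub>R decr_rearr M f s"
  have gm: "?g \<in> borel_measurable lborel"
  proof -
    have "(\<lambda>s. ennreal (decr_rearr M f s) * indicator {0<..<t} s) \<in> borel_measurable lborel"
      using t by (intro borel_measurable_decr_rearr_restricted u) auto
    then have "(\<lambda>s. enn2real (ennreal (decr_rearr M f s) * indicator {0<..<t} s)) \<in> borel_measurable lborel"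
      by measurable
    also have "(\<lambda>s. enn2real (ennreal (decr_rearr M f s) * indicator {0<..<t} s)) = ?g"
      using decr_rearr_nonneg[OF u] by (auto simp: fun_eq_iff split: split_indicator)
    finally show ?thesis .
  qed
  have gint: "integrable lborel ?g"
  proof (rule integrableI_bounded[OF gm])
    have "(\<integral>\<^sup>+ s. ennreal (norm (?g s)) \<partial>lborel) \<le> (\<integral>\<^sup>+ s. ennreal (decr_rearr M f s) * indicator {0<..<1} s \<partial>lborel)"
      using t decr_rearr_nonneg[OF u] by (intro nn_integral_mono) (auto split: split_indicator)
    also have "\<dots> = (\<integral>\<^sup>+ x. ennreal \<bar>f x\<bar> \<partial>M)"
      by (subst nn_integral_restrict_space[symmetric]) (auto intro!: nn_integral_decr_rearr u)
    also have "\<dots> < \<infinity>" using f by (auto simp: integrable_iff_bounded)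
    finally show "(\<integral>\<^sup>+ s. ennreal (norm (?g s)) \<partial>lborel) < \<infinity>" .
  qed
  have cint: "integrable lborel (\<lambda>s. indicator {0<..<t} s *\<^sub>R c)"
    using t by (intro integrable_scaleR_left integrable_real_indicator) auto
  have "t * (max_rearr M f t - decr_rearr M f t) = (\<integral>s. ?g s \<partial>lborel) - (\<integral>s. indicator {0<..<t} s *\<^sub>R c \<partial>lborel)"
    using t by (simp add: max_rearr_def set_lebesgue_integral_def c_def field_simps)
  also have "\<dots> = (\<integral>s. ?g s - indicator {0<..<t} s *\<^sub>R c \<partial>lborel)"
    using gint cint by (rule Bochner_Integration.integral_diff[symmetric])
  also have "ennreal \<dots> = (\<integral>\<^sup>+ s. ennreal (?g s - indicator {0<..<t} s *\<^sub>R c) \<partial>lborel)"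
    using gint cint decr_rearr_antimono[OF u, of _ t]
    by (intro nn_integral_eq_integral[symmetric]) (auto simp: c_def split: split_indicator)
  also have "\<dots> = (\<integral>\<^sup>+ s\<in>{0<..<t}. ennreal (decr_rearr M f s - c) \<partial>lborel)"
    by (intro nn_integral_cong) (auto split: split_indicator)
  also have "\<dots> = (\<integral>\<^sup>+ x. ennreal (\<bar>f x\<bar> - c) \<partial>M)"
    using t by (intro nn_integral_decr_rearr_truncated u) (auto simp: c_def ennreal_neg)
  finally show ?thesis
    by (simp add: nn_integral_excess_eq_distribution_fun[OF u] c_def)
qed

text \<open>Boundedness of \<open>u\<close> makes the Bochner integral on the right finite, so that it agrees with the integral in \<open>[0, \<infinity>]\<close>
  rather than defaulting to \<open>0\<close>.\<close>

lemma (in prob_space) nn_integral_powr_le_decr_rearr: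
  assumes u: "u \<in> borel_measurable M" and bounded: "\<And>x. x \<in> space M \<Longrightarrow> \<bar>u x\<bar> \<le> L" and q: "0 \<le> q"
    and E: "E \<in> sets M" and t: "prob E \<le> t" "0 < t" "t < 1"
  shows "(\<integral>\<^sup>+ x\<in>E. ennreal (\<bar>u x\<bar> powr q) \<partial>M) \<le> ennreal (LINT s:{0<..<t}|lborel. decr_rearr M u s powr q)"
proof -
  obtain x where "x \<in> space M" using not_empty by blast
  then have L: "0 \<le> L" using bounded[of x] abs_ge_zero[of "u x"] by linarith
  have "{x \<in> space M. L < \<bar>u x\<bar>} = {}" using bounded by force
  then have "distribution_fun M u L = 0" by (simp only: distribution_fun_def measure_empty)
  then have bd: "decr_rearr M u s \<le> L" if "0 < s" for s
    using less_decr_rearr_iff[OF u that L] that by auto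
  let ?g = "\<lambda>s. indicator {0<..<t} s *\<^sub>R (decr_rearr M u s powr q)"
  have h: "(\<lambda>l::real. ennreal (l powr q)) \<in> borel_measurable borel" by measurable
  have gm: "?g \<in> borel_measurable lborel"
  proof -
    have "(\<lambda>s. ennreal (decr_rearr M u s powr q) * indicator {0<..<t} s) \<in> borel_measurable lborel"
      using t by (intro borel_measurable_decr_rearr_restricted[OF u h]) auto
    then have "(\<lambda>s. enn2real (ennreal (decr_rearr M u s powr q) * indicator {0<..<t} s)) \<in> borel_measurable lborel"
      by measurable
    also have "(\<lambda>s. enn2real (ennreal (decr_rearr M u s powr q) * indicator {0<..<t} s)) = ?g"
      by (auto simp: fun_eq_iff split: split_indicator)
    finally show ?thesis .
  qed
  have gint: "integrable lborel ?g"
  proof (rule Bochner_Integration.integrable_bound[OF _ gm])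
    show "integrable lborel (\<lambda>s. indicator {0<..<t} s *\<^sub>R (L powr q))"
      using t by (intro integrable_scaleR_left integrable_real_indicator) auto
    show "AE s in lborel. norm (?g s) \<le> norm (indicator {0<..<t} s *\<^sub>R (L powr q))"
      using bd decr_rearr_nonneg[OF u] q by (auto intro!: powr_mono2 split: split_indicator)
  qed
  have "(\<integral>\<^sup>+ x\<in>E. ennreal (\<bar>u x\<bar> powr q) \<partial>M) \<le> (\<integral>\<^sup>+ s\<in>{0<..<t}. ennreal (decr_rearr M u s powr q) \<partial>lborel)"
    using q t by (intro nn_integral_set_le_decr_rearr[OF u h _ _ E]) (auto intro!: ennreal_leI powr_mono2)
  also have "\<dots> = (\<integral>\<^sup>+ s. ennreal (?g s) \<partial>lborel)"
    by (intro nn_integral_cong) (auto split: split_indicator)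
  also have "\<dots> = ennreal (LINT s:{0<..<t}|lborel. decr_rearr M u s powr q)"
    unfolding set_lebesgue_integral_def using gint by (intro nn_integral_eq_integral) auto
  finally show ?thesis .
qed


section \<open>Local slopes\<close>

text \<open>The supremum is formed in \<open>[0, \<infinity>]\<close>, where it is \<open>0\<close> if no other point is at distance less than \<open>h\<close>; this matches
  the value \<open>0\<close> of \<^const>\<open>grad_norm\<close> at isolated points.\<close>

definition local_slope :: "('a::metric_space \<Rightarrow> real) \<Rightarrow> real \<Rightarrow> 'a \<Rightarrow> ennreal" where
  "local_slope f h x = (SUP y\<in>{y. 0 < dist x y \<and> dist x y < h}. ennreal (\<bar>f x - f y\<bar> / dist x y))"

lemma local_slope_le_iff:
  assumes "0 \<le> c"
  shows "local_slope f h x \<le> ennreal c \<longleftrightarrow> (\<forall>y. 0 < dist x y \<longrightarrow> dist x y < h \<longrightarrow> \<bar>f x - f y\<bar> \<le> c * dist x y)"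
proof -
  have "\<bar>f x - f y\<bar> / dist x y \<le> c \<longleftrightarrow> \<bar>f x - f y\<bar> \<le> c * dist x y" if "x \<noteq> y" for y
    using that by (subst pos_divide_le_eq) auto
  then show ?thesis
    using assms unfolding local_slope_def SUP_le_iff by auto
qed

lemma local_slope_le_Lipschitz:
  assumes "L-lipschitz_on UNIV f"
  shows "local_slope f h x \<le> ennreal L"
  using assms lipschitz_on_nonneg[OF assms] 
  by (subst local_slope_le_iff) (auto simp: lipschitz_on_def dist_real_def)

lemma local_slope_mono: "h \<le> h' \<Longrightarrow> local_slope f h x \<le> local_slope f h' x"
  unfolding local_slope_def by (intro SUP_subset_mono) auto

lemma local_slope_abs_le: "local_slope (\<lambda>x. \<bar>f x\<bar>) h x \<le> local_slope f h x"
  unfolding local_slope_def by (intro SUP_mono) (auto intro!: divide_right_mono bexI simp: ennreal_leI)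

text \<open>For fixed \<open>y\<close> the difference quotient is continuous in \<open>x\<close> where it is defined, so the local slope is lower
  semicontinuous. Openness of its superlevel sets yields measurability although the competitors \<open>y\<close> may form
  an uncountable family.\<close>

lemma open_local_slope_greater:
  fixes f :: "'a::metric_space \<Rightarrow> real"
  assumes "continuous_on UNIV f"
  shows "open {x. c < local_slope f h x}"
proof -
  have "{x. c < local_slope f h x}
      = (\<Union>y. {x. 0 < dist x y \<and> dist x y < h \<and> c < ennreal (\<bar>f x - f y\<bar> / dist x y)})"
    by (auto simp: local_slope_def less_SUP_iff)
  also have "open \<dots>"
  proof (intro open_UN ballI)
    fix y :: 'a
    let ?U = "{x. 0 < dist x y \<and> dist x y < h}"
    have U: "open ?U" by (intro open_Collect_conj open_Collect_less continuous_intros)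
    have "continuous_on ?U (\<lambda>x. ennreal (\<bar>f x - f y\<bar> / dist x y))"
      using assms by (intro continuous_on_ennreal continuous_intros) (auto intro: continuous_on_subset)
    then have "open (?U \<inter> (\<lambda>x. ennreal (\<bar>f x - f y\<bar> / dist x y)) -` {c<..})"
      using U by (subst (asm) continuous_on_open_vimage) (auto simp: Int_commute)
    also have "?U \<inter> (\<lambda>x. ennreal (\<bar>f x - f y\<bar> / dist x y)) -` {c<..}
      = {x. 0 < dist x y \<and> dist x y < h \<and> c < ennreal (\<bar>f x - f y\<bar> / dist x y)}" by auto
    finally show "open {x. 0 < dist x y \<and> dist x y < h \<and> c < ennreal (\<bar>f x - f y\<bar> / dist x y)}" .
  qed
  finally show ?thesis .
qed

lemma borel_measurable_local_slope:
  assumes "continuous_on UNIV f"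
  shows "local_slope f h \<in> borel_measurable borel"
  using open_local_slope_greater[OF assms] by (intro borel_measurableI_greater) auto

lemma grad_norm_le_iff:
  fixes f :: "'a::metric_space \<Rightarrow> real"
  assumes lip: "L-lipschitz_on UNIV f" and c: "0 \<le> c"
  shows "grad_norm f x \<le> c \<longleftrightarrow>
    (\<forall>d>c. \<exists>h>0. \<forall>y. 0 < dist x y \<longrightarrow> dist x y < h \<longrightarrow> \<bar>f x - f y\<bar> < d * dist x y)"
proof -
  let ?q = "\<lambda>y. ereal (\<bar>f x - f y\<bar> / dist x y)"
  let ?l = "Limsup (at x) ?q"
  have "\<bar>f x - f y\<bar> / dist x y \<le> L" if "y \<noteq> x" for y
    using that lip by (subst pos_divide_le_eq) (auto simp: lipschitz_on_def dist_real_def)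
  then have "eventually (\<lambda>y. ?q y \<le> ereal L) (at x)"
    by (auto simp: eventually_at intro!: exI[of _ 1])
  then have "?l \<le> ereal L" by (rule Limsup_bounded)
  then have "?l \<noteq> \<infinity>" by auto
  then have "grad_norm f x \<le> c \<longleftrightarrow> ?l \<le> ereal c"
    using c unfolding grad_norm_def by (cases ?l) auto
  also have "\<dots> \<longleftrightarrow> (\<forall>d>c. eventually (\<lambda>y. ?q y < ereal d) (at x))"
  proof
    assume "?l \<le> ereal c"
    then show "\<forall>d>c. eventually (\<lambda>y. ?q y < ereal d) (at x)"
      using less_ereal.simps(1)[THEN iffD2] unfolding Limsup_le_iff by blast
  next
    assume *: "\<forall>d>c. eventually (\<lambda>y. ?q y < ereal d) (at x)"
    show "?l \<le> ereal c"
    proof (rule ereal_le_epsilon2)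
      fix e :: real assume "0 < e"
      then have "eventually (\<lambda>y. ?q y < ereal (c + e)) (at x)" using * by simp
      then show "?l \<le> ereal c + ereal e"
        by (intro Limsup_bounded) (auto elim!: eventually_mono)
    qed
  qed
  also have "\<dots> \<longleftrightarrow> (\<forall>d>c. \<exists>h>0. \<forall>y. 0 < dist x y \<longrightarrow> dist x y < h \<longrightarrow> \<bar>f x - f y\<bar> < d * dist x y)"
  proof (intro all_cong1 imp_cong refl)
    fix d
    have "?q y < ereal d \<longleftrightarrow> \<bar>f x - f y\<bar> < d * dist x y" if "y \<noteq> x" for y
      using that by (simp add: pos_divide_less_eq)
    then show "eventually (\<lambda>y. ?q y < ereal d) (at x) \<longleftrightarrow>
       (\<exists>h>0. \<forall>y. 0 < dist x y \<longrightarrow> dist x y < h \<longrightarrow> \<bar>f x - f y\<bar> < d * dist x y)"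
      unfolding eventually_at by (auto simp: dist_commute)
  qed
  finally show ?thesis .
qed

lemma grad_norm_nonneg:
  fixes f :: "'a::metric_space \<Rightarrow> real"
  shows "0 \<le> grad_norm f x"
proof (cases "at x = bot")
  case False
  then have "0 \<le> Limsup (at x) (\<lambda>y. ereal (\<bar>f x - f y\<bar> / dist x y))"
    by (intro le_Limsup) auto
  then show ?thesis unfolding grad_norm_def by (rule real_of_ereal_pos)
qed (simp add: grad_norm_def bot_ereal_def)

text \<open>The upper limit in the gradient is a decreasing limit of suprema, which gives its measurability and
  allows monotone convergence. Both sides are compared through the real upper bounds they admit.\<close>

lemma INF_local_slope_eq_grad_norm:
  fixes f :: "'a::metric_space \<Rightarrow> real"
  assumes lip: "L-lipschitz_on UNIV f"
  shows "(INF n. local_slope f (1 / real (Suc n)) x) = ennreal (grad_norm f x)"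
proof -
  have key: "(INF n. local_slope f (1 / real (Suc n)) x) \<le> ennreal c \<longleftrightarrow> grad_norm f x \<le> c" if c: "0 \<le> c" for c
  proof
    assume *: "(INF n. local_slope f (1 / real (Suc n)) x) \<le> ennreal c"
    show "grad_norm f x \<le> c"
      unfolding grad_norm_le_iff[OF lip c]
    proof (intro allI impI)
      fix d assume d: "c < d"
      define e where "e = (c + d) / 2"
      have e: "c < e" "e < d" using d by (auto simp: e_def)
      have "(INF n. local_slope f (1 / real (Suc n)) x) < ennreal e"
        using * e c by (auto simp: ennreal_less_iff intro: le_less_trans)
      then obtain n where "local_slope f (1 / real (Suc n)) x < ennreal e"
        unfolding INF_less_iff by auto
      then have n: "\<And>y. 0 < dist x y \<Longrightarrow> dist x y < 1 / real (Suc n) \<Longrightarrow> \<bar>f x - f y\<bar> \<le> e * dist x y"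
        using local_slope_le_iff[of e f "1 / real (Suc n)" x] e c by auto
      have "\<bar>f x - f y\<bar> < d * dist x y" if "0 < dist x y" "dist x y < 1 / real (Suc n)" for y
        using n[OF that] mult_strict_right_mono[OF e(2) that(1)] by linarith
      then show "\<exists>h>0. \<forall>y. 0 < dist x y \<longrightarrow> dist x y < h \<longrightarrow> \<bar>f x - f y\<bar> < d * dist x y"
        by (intro exI[of _ "1 / real (Suc n)"]) auto
    qed
  next
    assume *: "grad_norm f x \<le> c"
    show "(INF n. local_slope f (1 / real (Suc n)) x) \<le> ennreal c"
    proof (rule ennreal_le_epsilon)
      fix e :: real assume e: "0 < e"
      then obtain h where h: "h > 0" "\<And>y. 0 < dist x y \<Longrightarrow> dist x y < h \<Longrightarrow> \<bar>f x - f y\<bar> < (c + e) * dist x y"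
        using * unfolding grad_norm_le_iff[OF lip c] by (metis less_add_same_cancel1)
      obtain n where n: "1 / real (Suc n) < h" using h(1) nat_approx_posE by blast
      have "(INF n. local_slope f (1 / real (Suc n)) x) \<le> local_slope f (1 / real (Suc n)) x"
        by (rule INF_lower) simp
      also have "\<dots> \<le> ennreal (c + e)"
        using c e h(2) n by (subst local_slope_le_iff) (auto intro!: less_imp_le)
      finally show "(INF n. local_slope f (1 / real (Suc n)) x) \<le> ennreal c + ennreal e"
        using c e by simp
    qed
  qed
  have "local_slope f (1 / real (Suc 0)) x \<le> ennreal L"
    using lip by (rule local_slope_le_Lipschitz)
  then have "(INF n. local_slope f (1 / real (Suc n)) x) \<le> ennreal L"
    by (rule INF_lower2[rotated]) simp
  then obtain c where c: "(INF n. local_slope f (1 / real (Suc n)) x) = ennreal c" "0 \<le> c"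
    by (cases "INF n. local_slope f (1 / real (Suc n)) x") (auto simp: top_unique)
  show ?thesis
  proof (rule antisym)
    show "(INF n. local_slope f (1 / real (Suc n)) x) \<le> ennreal (grad_norm f x)"
      using key[OF grad_norm_nonneg[of f x]] by blast
    show "ennreal (grad_norm f x) \<le> (INF n. local_slope f (1 / real (Suc n)) x)"
      using key[OF c(2)] c by (auto intro: ennreal_leI)
  qed
qed

lemma borel_measurable_grad_norm:
  fixes f :: "'a::metric_space \<Rightarrow> real"
  assumes lip: "L-lipschitz_on UNIV f"
  shows "grad_norm f \<in> borel_measurable borel"
proof -
  have "(\<lambda>x. INF n. local_slope f (1 / real (Suc n)) x) \<in> borel_measurable borel"
    using borel_measurable_local_slope[OF lipschitz_on_continuous_on[OF lip]] by measurable
  then have "(\<lambda>x. enn2real (ennreal (grad_norm f x))) \<in> borel_measurable borel"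
    unfolding INF_local_slope_eq_grad_norm[OF lip] by measurable
  then show ?thesis by (simp add: grad_norm_nonneg)
qed

lemma grad_norm_le_Lipschitz:
  fixes f :: "'a::metric_space \<Rightarrow> real"
  assumes lip: "L-lipschitz_on UNIV f"
  shows "grad_norm f x \<le> L"
proof -
  have "local_slope f (1 / real (Suc 0)) x \<le> ennreal L"
    using lip by (rule local_slope_le_Lipschitz)
  then have "(INF n. local_slope f (1 / real (Suc n)) x) \<le> ennreal L"
    by (rule INF_lower2[rotated]) simp
  then show ?thesis using lipschitz_on_nonneg[OF lip] unfolding INF_local_slope_eq_grad_norm[OF lip] by simp
qed

lemma lipschitz_on_abs:
  fixes f :: "'a::metric_space \<Rightarrow> real"
  assumes lip: "L-lipschitz_on X f"
  shows "L-lipschitz_on X (\<lambda>x. \<bar>f x\<bar>)"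
  using assms unfolding lipschitz_on_def dist_real_def by (meson abs_triangle_ineq3 order_trans)

lemma grad_norm_abs_le:
  fixes f :: "'a::metric_space \<Rightarrow> real"
  assumes lip: "L-lipschitz_on UNIV f"
  shows "grad_norm (\<lambda>x. \<bar>f x\<bar>) x \<le> grad_norm f x"
proof -
  have "ennreal (grad_norm (\<lambda>x. \<bar>f x\<bar>) x) \<le> ennreal (grad_norm f x)"
    unfolding INF_local_slope_eq_grad_norm[OF lip, symmetric]
      INF_local_slope_eq_grad_norm[OF lipschitz_on_abs[OF lip], symmetric]
    by (intro INF_mono bexI) (rule local_slope_abs_le, simp)
  then show ?thesis by (simp add: grad_norm_nonneg)
qed

text \<open>The function whose superlevel sets are the enlargements of those of \<open>f\<close>.\<close>

definition ball_sup :: "('a::metric_space \<Rightarrow> real) \<Rightarrow> real \<Rightarrow> 'a \<Rightarrow> real" where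
  "ball_sup f h x = (SUP y\<in>ball x h. f y)"

lemma Lipschitz_le_on_ball:
  fixes f :: "'a::metric_space \<Rightarrow> real"
  assumes lip: "L-lipschitz_on UNIV f" and y: "y \<in> ball x h"
  shows "f y \<le> f x + L * h"
proof -
  have "f y - f x \<le> L * dist x y" using lip by (auto simp: lipschitz_on_def dist_real_def abs_le_iff)
  also have "\<dots> \<le> L * h" using y lipschitz_on_nonneg[OF lip] by (intro mult_left_mono) auto
  finally show ?thesis by simp
qed

lemma enlargement_superlevel:
  fixes f :: "'a::metric_space \<Rightarrow> real"
  assumes lip: "L-lipschitz_on UNIV f" and h: "0 < h"
  shows "enlargement {y. l < f y} h = {x. l < ball_sup f h x}"
proof -
  have "x \<in> enlargement {y. l < f y} h \<longleftrightarrow> (\<exists>y\<in>ball x h. l < f y)" for x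
  proof (cases "{y. l < f y} = {}")
    case True then show ?thesis by (auto simp: enlargement_def)
  next
    case False
    then have "infdist x {y. l < f y} < h \<longleftrightarrow> (\<exists>y\<in>{y. l < f y}. dist x y < h)"
      by (subst infdist_notempty, simp, subst cINF_less_iff) (auto intro!: bdd_belowI[of _ 0])
    then show ?thesis using False by (auto simp: enlargement_def)
  qed
  moreover have "l < ball_sup f h x \<longleftrightarrow> (\<exists>y\<in>ball x h. l < f y)" for x
    unfolding ball_sup_def using h Lipschitz_le_on_ball[OF lip]
    by (subst less_cSUP_iff) (auto intro!: bdd_aboveI)
  ultimately show ?thesis by blast
qed

lemma open_enlargement: "open (enlargement A h)"
  unfolding enlargement_def by (cases "A = {}") (auto intro!: open_Collect_less continuous_intros)

lemma borel_measurable_ball_sup: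
  fixes f :: "'a::metric_space \<Rightarrow> real"
  assumes lip: "L-lipschitz_on UNIV f" and h: "0 < h"
  shows "ball_sup f h \<in> borel_measurable borel"
proof (rule borel_measurableI_greater)
  fix l
  have "{x \<in> space borel. l < ball_sup f h x} = enlargement {y. l < f y} h"
    by (simp add: enlargement_superlevel[OF assms])
  then show "{x \<in> space borel. l < ball_sup f h x} \<in> sets borel"
    using borel_open[OF open_enlargement] by simp
qed

lemma ball_sup_bounds:
  fixes f :: "'a::metric_space \<Rightarrow> real"
  assumes lip: "L-lipschitz_on UNIV f" and h: "0 < h"
  shows "f x \<le> ball_sup f h x" "ball_sup f h x \<le> f x + L * h"
    "ennreal (ball_sup f h x - f x) \<le> ennreal h * local_slope f h x"
proof -
  have bdd: "bdd_above (f ` ball x h)" using Lipschitz_le_on_ball[OF lip] by (auto intro!: bdd_aboveI)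
  show "f x \<le> ball_sup f h x" unfolding ball_sup_def using h bdd by (intro cSUP_upper) auto
  show "ball_sup f h x \<le> f x + L * h"
    unfolding ball_sup_def using h Lipschitz_le_on_ball[OF lip] by (intro cSUP_least) auto
  obtain c where c: "local_slope f h x = ennreal c" "0 \<le> c"
    using local_slope_le_Lipschitz[OF lip, of h x] by (cases "local_slope f h x") (auto simp: top_unique)
  have slope: "\<bar>f x - f y\<bar> \<le> c * dist x y" if "0 < dist x y" "dist x y < h" for y
    using local_slope_le_iff[OF c(2), of f h x] c(1) that by simp
  have "ball_sup f h x \<le> f x + h * c"
    unfolding ball_sup_def
  proof (rule cSUP_least)
    fix y assume y: "y \<in> ball x h"
    have "f y - f x \<le> c * dist x y" using slope[of y] y by (cases "x = y") auto
    also have "\<dots> \<le> c * h" using y c by (intro mult_left_mono) auto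
    finally show "f y \<le> f x + h * c" by (simp add: mult.commute)
  qed (use h in simp)
  then show "ennreal (ball_sup f h x - f x) \<le> ennreal h * local_slope f h x"
    unfolding c(1) using h c(2) by (subst ennreal_mult[symmetric]) (auto intro!: ennreal_leI)
qed

section \<open>The coarea inequality\<close>

text \<open>The isoperimetric inequality along the scales \<open>1 / (n + 1)\<close>, in the form to which Fatou's lemma applies.\<close>

lemma ennreal_profile_le_liminf:
  assumes prof: "isoperimetric_minorant M I" and A: "A \<in> sets borel"
  shows "ennreal (I (measure M A)) \<le>
    liminf (\<lambda>n. ennreal ((measure M (enlargement A (1 / real (Suc n))) - measure M A) / (1 / real (Suc n))))"
  unfolding le_Liminf_iff
proof (intro allI impI)
  fix y assume y: "y < ennreal (I (measure M A))"
  obtain r where r: "y = ennreal r" "0 \<le> r" using y by (cases y) auto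
  have "ereal r < ereal (I (measure M A))" using y r by (simp add: ennreal_less_iff)
  also have "\<dots> \<le> Liminf (at_right 0) (\<lambda>h. ereal ((measure M (enlargement A h) - measure M A) / h))"
    using prof A unfolding isoperimetric_minorant_def minkowski_content_def by blast
  finally have "eventually (\<lambda>h. r < (measure M (enlargement A h) - measure M A) / h) (at_right 0)"
    by (auto dest: less_LiminfD)
  moreover have "filterlim (\<lambda>n. 1 / real (Suc n)) (at_right 0) sequentially"
    using LIMSEQ_inverse_real_of_nat
    by (intro tendsto_imp_filterlim_at_right) (auto simp: inverse_eq_divide)
  ultimately have "eventually (\<lambda>n. r < (measure M (enlargement A (1 / real (Suc n))) - measure M A) / (1 / real (Suc n))) sequentially"
    by (rule eventually_compose_filterlim)
  then show "eventually (\<lambda>n. y < ennreal ((measure M (enlargement A (1 / real (Suc n))) - measure M A) / (1 / real (Suc n)))) sequentially"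
    by eventually_elim (simp only: r ennreal_less_iff[OF r(2)])
qed

lemma borel_measurable_superlevel_measure:
  fixes g :: "'a::topological_space \<Rightarrow> real"
  assumes prob: "prob_space M" and sets: "sets M = sets borel" and g: "g \<in> borel_measurable borel"
  shows "(\<lambda>l. measure M {x. l < g x}) \<in> borel_measurable borel"
proof -
  interpret prob_space M by fact
  have "{x. l < g x} \<in> sets M" for l
    using measurable_sets[OF g, of "{l<..}"] by (simp add: vimage_def sets)
  then have "mono (\<lambda>l. - measure M {x. l < g x})"
    unfolding mono_def by (intro allI impI le_imp_neg_le finite_measure_mono) auto
  then have "(\<lambda>l. - (- measure M {x. l < g x})) \<in> borel_measurable borel"
    by (intro borel_measurable_uminus borel_measurable_mono)
  then show ?thesis by simp
qed

text \<open>By Tonelli's theorem the increments of the level-set measures integrate to the length of the set of \<open>l \<in> K\<close>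
  with \<open>f x \<le> l < ball_sup f h x\<close>, an interval of length at most \<open>h\<close> times the local slope. It meets \<open>K\<close> only if
  \<open>f x\<close> is within \<open>L h\<close> of \<open>K\<close>, which keeps the estimate localised to the levels under consideration.\<close>

lemma coarea_enlargement_le:
  fixes f :: "'a::metric_space \<Rightarrow> real"
  assumes "prob_space M" and sets[measurable_cong]: "sets M = sets borel"
    and lip: "L-lipschitz_on UNIV f" and h: "0 < h" and K[measurable]: "K \<in> sets borel"
  shows "(\<integral>\<^sup>+ l\<in>K. ennreal ((measure M (enlargement {x. l < f x} h) - measure M {x. l < f x}) / h) \<partial>lborel)
    \<le> (\<integral>\<^sup>+ x. local_slope f h x * indicator {x. infdist (f x) K \<le> L * h} x \<partial>M)"
proof -
  interpret prob_space M by fact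
  interpret P: pair_sigma_finite lborel M by standard
  have sp: "space M = UNIV" using sets_eq_imp_space_eq[OF sets] by simp
  have cf: "continuous_on UNIV f" using lip by (rule lipschitz_on_continuous_on)
  have [measurable]: "f \<in> borel_measurable M"
    using borel_measurable_continuous_onI[OF cf] measurable_cong_sets[OF sets refl] by blast
  have [measurable]: "ball_sup f h \<in> borel_measurable M"
    using borel_measurable_ball_sup[OF lip h] measurable_cong_sets[OF sets refl] by blast
  have [measurable]: "local_slope f h \<in> borel_measurable M"
    using borel_measurable_local_slope[OF cf] measurable_cong_sets[OF sets refl] by blast
  have "closed {x. infdist (f x) K \<le> L * h}"
    by (intro closed_Collect_le continuous_intros cf)
  then have [measurable]: "{x. infdist (f x) K \<le> L * h} \<in> sets M"
    unfolding sets by (rule borel_closed)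
  let ?S = "\<lambda>l x. indicator {p \<in> space (lborel \<Otimes>\<^sub>M M). fst p \<in> K \<and> f (snd p) \<le> fst p \<and> fst p < ball_sup f h (snd p)} (l, x) :: ennreal"
  have S: "?S l x = indicator K l * indicator ({x. l < ball_sup f h x} - {x. l < f x}) x" for l x
    by (auto simp: space_pair_measure sp split: split_indicator)
  have "(\<integral>\<^sup>+ l\<in>K. ennreal ((measure M (enlargement {x. l < f x} h) - measure M {x. l < f x}) / h) \<partial>lborel)
      = (\<integral>\<^sup>+ l. ennreal (1 / h) * (\<integral>\<^sup>+ x. ?S l x \<partial>M) \<partial>lborel)"
  proof (intro nn_integral_cong)
    fix l
    have sup_meas: "{x. l < ball_sup f h x} \<in> sets M"
      using measurable_sets[of "ball_sup f h" M borel "{l<..}"] by (simp add: vimage_def sp)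
    have f_meas: "{x. l < f x} \<in> sets M"
      using measurable_sets[of "f" M borel "{l<..}"] by (simp add: vimage_def sp)
    have sub: "{x. l < f x} \<subseteq> {x. l < ball_sup f h x}"
      using ball_sup_bounds(1)[OF lip h] by (auto intro: less_le_trans)
    have "(\<integral>\<^sup>+ x. ?S l x \<partial>M) = indicator K l * emeasure M ({x. l < ball_sup f h x} - {x. l < f x})"
      unfolding S using sup_meas f_meas by (subst nn_integral_cmult_indicator) auto
    also have "emeasure M ({x. l < ball_sup f h x} - {x. l < f x})
        = ennreal (measure M (enlargement {x. l < f x} h) - measure M {x. l < f x})"
      unfolding enlargement_superlevel[OF lip h] emeasure_eq_measure
      by (subst finite_measure_Diff[OF sup_meas f_meas sub]) rule
    finally show "ennreal ((measure M (enlargement {x. l < f x} h) - measure M {x. l < f x}) / h) * indicator K l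
      = ennreal (1 / h) * (\<integral>\<^sup>+ x. ?S l x \<partial>M)"
      using h by (simp add: ennreal_mult'[symmetric] mult.left_commute mult.commute split: split_indicator)
  qed
  also have "\<dots> = ennreal (1 / h) * (\<integral>\<^sup>+ l. (\<integral>\<^sup>+ x. ?S l x \<partial>M) \<partial>lborel)"
    by (intro nn_integral_cmult borel_measurable_nn_integral_fst) measurable
  also have "(\<integral>\<^sup>+ l. (\<integral>\<^sup>+ x. ?S l x \<partial>M) \<partial>lborel) = (\<integral>\<^sup>+ x. (\<integral>\<^sup>+ l. ?S l x \<partial>lborel) \<partial>M)"
    by (intro P.Fubini[symmetric]) measurable
  also have "ennreal (1 / h) * (\<integral>\<^sup>+ x. (\<integral>\<^sup>+ l. ?S l x \<partial>lborel) \<partial>M)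
      \<le> ennreal (1 / h) * (\<integral>\<^sup>+ x. ennreal h * (local_slope f h x * indicator {x. infdist (f x) K \<le> L * h} x) \<partial>M)"
  proof (intro mult_left_mono nn_integral_mono)
    fix x
    show "(\<integral>\<^sup>+ l. ?S l x \<partial>lborel) \<le> ennreal h * (local_slope f h x * indicator {x. infdist (f x) K \<le> L * h} x)"
    proof (cases "infdist (f x) K \<le> L * h")
      case True
      have "(\<integral>\<^sup>+ l. ?S l x \<partial>lborel) \<le> (\<integral>\<^sup>+ l. indicator {f x..<ball_sup f h x} l \<partial>lborel)"
        unfolding S by (intro nn_integral_mono) (auto split: split_indicator)
      also have "\<dots> = ennreal (ball_sup f h x - f x)"
        using ball_sup_bounds(1)[OF lip h] by simp
      also have "\<dots> \<le> ennreal h * local_slope f h x" by (rule ball_sup_bounds(3)[OF lip h])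
      finally show ?thesis using True by simp
    next
      case False
      have "?S l x = 0" for l
      proof -
        have "l \<notin> K \<or> l < f x \<or> ball_sup f h x \<le> l"
        proof (rule ccontr)
          assume *: "\<not> ?thesis"
          then have "infdist (f x) K \<le> dist (f x) l" by (intro infdist_le) auto
          also have "\<dots> \<le> L * h" using * ball_sup_bounds(2)[OF lip h, of x] by (auto simp: dist_real_def)
          finally show False using False by simp
        qed
        then show ?thesis by auto
      qed
      then show ?thesis by simp
    qed
  qed simp
  also have "\<dots> = ennreal (1 / h) * (ennreal h * (\<integral>\<^sup>+ x. local_slope f h x * indicator {x. infdist (f x) K \<le> L * h} x \<partial>M))"
    by (subst nn_integral_cmult) measurable
  also have "\<dots> = (\<integral>\<^sup>+ x. local_slope f h x * indicator {x. infdist (f x) K \<le> L * h} x \<partial>M)"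
    using h by (simp add: mult.assoc[symmetric] ennreal_mult'[symmetric])
  finally show ?thesis .
qed

text \<open>Limit \<open>h \<rightarrow> 0\<close> of the previous estimate. Closedness of \<open>K\<close> is what makes the neighbourhoods of \<open>K\<close> shrink
  to \<open>K\<close> itself.\<close>

lemma coarea_closed_le:
  fixes f :: "'a::metric_space \<Rightarrow> real"
  assumes prob: "prob_space M" and sets[measurable_cong]: "sets M = sets borel"
    and prof: "isoperimetric_minorant M I"
    and lip: "L-lipschitz_on UNIV f" and K: "closed K"
  shows "(\<integral>\<^sup>+ l\<in>K. ennreal (I (measure M {x. l < f x})) \<partial>lborel)
    \<le> (\<integral>\<^sup>+ x. ennreal (grad_norm f x) * indicator K (f x) \<partial>M)"
proof (cases "K = {}")
  case False
  interpret prob_space M by fact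
  have cf: "continuous_on UNIV f" using lip by (rule lipschitz_on_continuous_on)
  have fm[measurable]: "f \<in> borel_measurable M"
    using borel_measurable_continuous_onI[OF cf] measurable_cong_sets[OF sets refl] by blast
  have Km[measurable]: "K \<in> sets borel" using K by (rule borel_closed)
  have f_lev: "{x. l < f x} \<in> sets borel" for l
    using borel_measurable_continuous_onI[OF cf] measurable_sets[of f borel borel "{l<..}"] by (simp add: vimage_def)
  let ?h = "\<lambda>n. 1 / real (Suc n)"
  define D where "D n l = ennreal ((measure M (enlargement {x. l < f x} (?h n)) - measure M {x. l < f x}) / ?h n)" for n l
  define H where "H n x = local_slope f (?h n) x * indicator {x. infdist (f x) K \<le> L * ?h n} x" for n x
  have L0: "0 \<le> L" using lip by (rule lipschitz_on_nonneg)
  have Dm[measurable]: "D n \<in> borel_measurable borel" for n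
  proof -
    have "0 < ?h n" by simp
    note e = enlargement_superlevel[OF lip this] and b = borel_measurable_ball_sup[OF lip this]
    show ?thesis unfolding D_def e
      using borel_measurable_superlevel_measure[OF prob sets b]
        borel_measurable_superlevel_measure[OF prob sets borel_measurable_continuous_onI[OF cf]] by measurable
  qed
  have Hm: "H n \<in> borel_measurable M" for n
  proof -
    have [measurable]: "local_slope f (?h n) \<in> borel_measurable M"
      using borel_measurable_local_slope[OF cf] measurable_cong_sets[OF sets refl] by blast
    have "closed {x. infdist (f x) K \<le> L * ?h n}"
      by (intro closed_Collect_le continuous_intros cf)
    then have [measurable]: "{x. infdist (f x) K \<le> L * ?h n} \<in> sets M"
      unfolding sets by (rule borel_closed)
    show ?thesis unfolding H_def by measurable
  qed
  have H_dec: "decseq H"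
  proof (rule decseq_SucI, rule le_funI)
    fix n x
    have h: "?h (Suc n) \<le> ?h n" by (simp add: frac_le)
    then have "L * ?h (Suc n) \<le> L * ?h n" using L0 by (rule mult_left_mono)
    then show "H (Suc n) x \<le> H n x"
      unfolding H_def by (intro mult_mono local_slope_mono h) (auto split: split_indicator)
  qed
  have "(\<integral>\<^sup>+ x. H 0 x \<partial>M) \<le> (\<integral>\<^sup>+ x. ennreal L \<partial>M)"
    using local_slope_le_Lipschitz[OF lip] by (intro nn_integral_mono) (auto simp: H_def split: split_indicator)
  then have H_fin: "(\<integral>\<^sup>+ x. H 0 x \<partial>M) < \<infinity>"
    by (rule le_less_trans) (simp add: emeasure_space_1)
  have "(\<integral>\<^sup>+ l\<in>K. ennreal (I (measure M {x. l < f x})) \<partial>lborel)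
      \<le> (\<integral>\<^sup>+ l. liminf (\<lambda>n. D n l * indicator K l) \<partial>lborel)"
  proof (intro nn_integral_mono)
    fix l
    show "ennreal (I (measure M {x. l < f x})) * indicator K l \<le> liminf (\<lambda>n. D n l * indicator K l)"
      using ennreal_profile_le_liminf[OF prof f_lev[of l]]
      by (auto simp: D_def split: split_indicator)
  qed
  also have "\<dots> \<le> liminf (\<lambda>n. \<integral>\<^sup>+ l\<in>K. D n l \<partial>lborel)"
    by (intro nn_integral_liminf) measurable
  also have "\<dots> \<le> liminf (\<lambda>n. integral\<^sup>N M (H n))"
    unfolding D_def H_def
    by (intro Liminf_mono always_eventually allI coarea_enlargement_le prob sets lip Km) simp
  also have "\<dots> = (INF n. integral\<^sup>N M (H n))"
    using decseqD[OF H_dec]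
    by (intro lim_imp_Liminf LIMSEQ_INF) (auto simp: decseq_def le_fun_def intro!: nn_integral_mono)
  also have "\<dots> = (\<integral>\<^sup>+ x. (INF n. H n x) \<partial>M)"
    using H_dec Hm H_fin by (rule nn_integral_monotone_convergence_INF_decseq[symmetric])
  also have "\<dots> \<le> (\<integral>\<^sup>+ x. ennreal (grad_norm f x) * indicator K (f x) \<partial>M)"
  proof (intro nn_integral_mono)
    fix x
    show "(INF n. H n x) \<le> ennreal (grad_norm f x) * indicator K (f x)"
    proof (cases "f x \<in> K")
      case True
      then have "(INF n. H n x) = (INF n. local_slope f (?h n) x)"
        using L0 by (simp add: H_def)
      then show ?thesis using True INF_local_slope_eq_grad_norm[OF lip] by simp
    next
      case fx: False
      then have pos: "0 < infdist (f x) K" using K False by (intro infdist_pos_not_in_closed) auto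
      have "(\<lambda>n. L * inverse (real (Suc n))) \<longlonglongrightarrow> L * 0"
        by (intro tendsto_intros LIMSEQ_inverse_real_of_nat)
      then have "eventually (\<lambda>n. L * inverse (real (Suc n)) < infdist (f x) K) sequentially"
        using pos by (intro order_tendstoD) auto
      then obtain n where n: "L * inverse (real (Suc n)) < infdist (f x) K"
        by (auto simp: eventually_sequentially)
      then have "H n x = 0" by (auto simp: H_def inverse_eq_divide)
      then have "(INF n. H n x) \<le> 0" by (metis INF_lower UNIV_I)
      then show ?thesis using fx by simp
    qed
  qed
  finally show ?thesis .
qed simp

lemma nn_integral_mono_emeasure:
  assumes sets: "sets M = sets N" and le: "\<And>A. A \<in> sets M \<Longrightarrow> emeasure M A \<le> emeasure N A"
    and f: "f \<in> borel_measurable M"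
  shows "integral\<^sup>N M f \<le> integral\<^sup>N N f"
  using f
proof (induction rule: borel_measurable_induct)
  case (cong f g)
  then have "integral\<^sup>N M f = integral\<^sup>N M g" "integral\<^sup>N N f = integral\<^sup>N N g"
    using sets_eq_imp_space_eq[OF sets] by (auto intro!: nn_integral_cong)
  then show ?case using cong by simp
next
  case (set A)
  then show ?case using le sets by simp
next
  case (mult u c)
  then have "u \<in> borel_measurable N" using measurable_cong_sets[OF sets refl] by blast
  then show ?case using mult by (simp add: nn_integral_cmult mult_left_mono)
next
  case (add u v)
  then have "u \<in> borel_measurable N" "v \<in> borel_measurable N"
    using measurable_cong_sets[OF sets refl] by blast+
  then show ?case using add by (simp add: nn_integral_add add_mono)
next
  case (seq U)
  then have m: "U i \<in> borel_measurable N" for i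
    using measurable_cong_sets[OF sets refl] by blast
  have "integral\<^sup>N M (SUP i. U i) = (SUP i. integral\<^sup>N M (U i))"
    using seq by (subst nn_integral_monotone_convergence_SUP[symmetric]) (auto intro!: nn_integral_cong simp: SUP_apply image_image)
  also have "\<dots> \<le> (SUP i. integral\<^sup>N N (U i))"
    using seq by (intro SUP_mono) blast
  also have "\<dots> = integral\<^sup>N N (SUP i. U i)"
    using seq m by (subst nn_integral_monotone_convergence_SUP[symmetric]) (auto intro!: nn_integral_cong simp: SUP_apply image_image)
  finally show ?case .
qed

text \<open>Both sides are integrals of \<open>\<phi>\<close> against measures on the line. The inequality between these measures on closed
  sets extends to Borel sets by inner regularity of the left one, which is finite because the right one is.\<close>

lemma coarea_weighted_le:
  fixes f :: "'a::metric_space \<Rightarrow> real"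
  assumes prob: "prob_space M" and sets[measurable_cong]: "sets M = sets borel"
    and prof: "isoperimetric_minorant M I" and cont: "continuous_on {0..1} I"
    and lip: "L-lipschitz_on UNIV f" and phi[measurable]: "\<phi> \<in> borel_measurable borel"
  shows "(\<integral>\<^sup>+ l. \<phi> l * ennreal (I (measure M {x. l < f x})) \<partial>lborel)
    \<le> (\<integral>\<^sup>+ x. \<phi> (f x) * ennreal (grad_norm f x) \<partial>M)"
proof -
  interpret prob_space M by fact
  have cf: "continuous_on UNIV f" using lip by (rule lipschitz_on_continuous_on)
  have fm[measurable]: "f \<in> borel_measurable M"
    using borel_measurable_continuous_onI[OF cf] measurable_cong_sets[OF sets refl] by blast
  have gm[measurable]: "grad_norm f \<in> borel_measurable M"
    using borel_measurable_grad_norm[OF lip] measurable_cong_sets[OF sets refl] by blast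
  have [measurable]: "(\<lambda>s. indicator {0..1} s *\<^sub>R I s) \<in> borel_measurable borel"
    using cont by (intro borel_measurable_continuous_on_indicator) auto
  have [measurable]: "(\<lambda>l. measure M {x. l < f x}) \<in> borel_measurable borel"
    using borel_measurable_superlevel_measure[OF prob sets borel_measurable_continuous_onI[OF cf]] .
  have "(\<lambda>l. indicator {0..1} (measure M {x. l < f x}) *\<^sub>R I (measure M {x. l < f x})) \<in> borel_measurable borel"
    by measurable
  then have Im[measurable]: "(\<lambda>l. I (measure M {x. l < f x})) \<in> borel_measurable borel"
    by (simp add: indicator_def)
  define N1 where "N1 = density lborel (\<lambda>l. ennreal (I (measure M {x. l < f x})))"
  define N2 where "N2 = distr (density M (\<lambda>x. ennreal (grad_norm f x))) borel f"
  have N1: "emeasure N1 B = (\<integral>\<^sup>+ l\<in>B. ennreal (I (measure M {x. l < f x})) \<partial>lborel)" if "B \<in> sets borel" for B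
    unfolding N1_def using that by (subst emeasure_density) auto
  have N2: "emeasure N2 B = (\<integral>\<^sup>+ x. ennreal (grad_norm f x) * indicator B (f x) \<partial>M)" if "B \<in> sets borel" for B
  proof -
    have "f -` B \<inter> space M \<in> sets M" using that by measurable
    then have "emeasure N2 B = (\<integral>\<^sup>+ x. ennreal (grad_norm f x) * indicator (f -` B \<inter> space M) x \<partial>M)"
      unfolding N2_def using that
      by (subst emeasure_distr) (auto simp: emeasure_density)
    also have "\<dots> = (\<integral>\<^sup>+ x. ennreal (grad_norm f x) * indicator B (f x) \<partial>M)"
      by (intro nn_integral_cong) (auto split: split_indicator)
    finally show ?thesis .
  qed
  have cl: "emeasure N1 K \<le> emeasure N2 K" if "closed K" for K
    using coarea_closed_le[OF prob sets prof lip that] that by (simp add: N1 N2)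
  have sets1: "sets N1 = sets borel" by (simp add: N1_def)
  have sets2: "sets N2 = sets borel" by (simp add: N2_def)
  have "emeasure N1 UNIV \<le> emeasure N2 UNIV" by (rule cl) simp
  also have "\<dots> \<le> (\<integral>\<^sup>+ x. ennreal L \<partial>M)"
    using grad_norm_le_Lipschitz[OF lip] by (subst N2) (auto intro!: nn_integral_mono ennreal_leI simp del: nn_integral_const)
  also have "\<dots> < \<infinity>" by (simp add: emeasure_space_1)
  finally have fin: "emeasure N1 (space N1) \<noteq> \<infinity>" by (simp add: N1_def)
  have "emeasure N1 B \<le> emeasure N2 B" if B: "B \<in> sets borel" for B
  proof -
    have "emeasure N1 B = (SUP K \<in> {K. K \<subseteq> B \<and> compact K}. emeasure N1 K)"
      by (rule inner_regular[OF sets1 fin B])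
    also have "\<dots> \<le> emeasure N2 B"
    proof (rule SUP_least)
      fix K assume K: "K \<in> {K. K \<subseteq> B \<and> compact K}"
      then have "emeasure N1 K \<le> emeasure N2 K" by (intro cl) (auto intro: compact_imp_closed)
      also have "\<dots> \<le> emeasure N2 B" using K B sets2 by (intro emeasure_mono) auto
      finally show "emeasure N1 K \<le> emeasure N2 B" .
    qed
    finally show ?thesis .
  qed
  then have "integral\<^sup>N N1 \<phi> \<le> integral\<^sup>N N2 \<phi>"
    using sets1 sets2 phi measurable_cong_sets[OF sets1 refl]
    by (intro nn_integral_mono_emeasure) auto
  also have "integral\<^sup>N N1 \<phi> = (\<integral>\<^sup>+ l. \<phi> l * ennreal (I (measure M {x. l < f x})) \<partial>lborel)"
    unfolding N1_def by (subst nn_integral_density) (auto simp: mult.commute)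
  also have "integral\<^sup>N N2 \<phi> = (\<integral>\<^sup>+ x. \<phi> (f x) * ennreal (grad_norm f x) \<partial>M)"
    unfolding N2_def by (subst nn_integral_distr) (auto simp: nn_integral_density mult.commute)
  finally show ?thesis .
qed

lemma coarea_distribution_fun_le:
  fixes f :: "'a::metric_space \<Rightarrow> real"
  assumes prob: "prob_space M" and sets: "sets M = sets borel"
    and prof: "isoperimetric_minorant M I" and cont: "continuous_on {0..1} I"
    and lip: "L-lipschitz_on UNIV f" and phi: "\<phi> \<in> borel_measurable borel"
  shows "(\<integral>\<^sup>+ l. \<phi> l * ennreal (I (distribution_fun M f l)) \<partial>lborel)
    \<le> (\<integral>\<^sup>+ x. \<phi> \<bar>f x\<bar> * ennreal (grad_norm f x) \<partial>M)"
proof -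
  have "space M = UNIV" using sets_eq_imp_space_eq[OF sets] by simp
  then have "(\<integral>\<^sup>+ l. \<phi> l * ennreal (I (distribution_fun M f l)) \<partial>lborel)
    \<le> (\<integral>\<^sup>+ x. \<phi> \<bar>f x\<bar> * ennreal (grad_norm (\<lambda>x. \<bar>f x\<bar>) x) \<partial>M)"
    using coarea_weighted_le[OF prob sets prof cont lipschitz_on_abs[OF lip] phi]
    by (simp add: distribution_fun_def)
  also have "\<dots> \<le> (\<integral>\<^sup>+ x. \<phi> \<bar>f x\<bar> * ennreal (grad_norm f x) \<partial>M)"
    by (intro nn_integral_mono mult_left_mono ennreal_leI grad_norm_abs_le[OF lip]) simp
  finally show ?thesis .
qed

section \<open>The oscillation of the rearrangement\<close>

text \<open>Young's inequality for \<open>a / A\<^sup>1\<^sup>/\<^sup>p\<close> and \<open>b / B\<^sup>1\<^sup>/\<^sup>q\<close>, integrated.\<close>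

lemma nn_integral_Holder:
  fixes a b :: "'a \<Rightarrow> real"
  assumes pq: "1 < p" "1 < q" "1 / p + 1 / q = 1"
    and [measurable]: "a \<in> borel_measurable M" "b \<in> borel_measurable M"
    and nonneg: "\<And>x. 0 \<le> a x" "\<And>x. 0 \<le> b x" "0 \<le> A" "0 \<le> B"
    and A: "(\<integral>\<^sup>+ x. ennreal (a x powr p) \<partial>M) \<le> ennreal A"
    and B: "(\<integral>\<^sup>+ x. ennreal (b x powr q) \<partial>M) \<le> ennreal B"
  shows "(\<integral>\<^sup>+ x. ennreal (a x * b x) \<partial>M) \<le> ennreal (A powr (1 / p) * B powr (1 / q))"
proof (cases "A = 0 \<or> B = 0")
  case True
  have "AE x in M. a x * b x = 0"
    using True
  proof
    assume "A = 0"
    then have "(\<integral>\<^sup>+ x. ennreal (a x powr p) \<partial>M) = 0" using A by simp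
    then have "AE x in M. ennreal (a x powr p) = 0" by (subst (asm) nn_integral_0_iff_AE) auto
    then show ?thesis by eventually_elim (simp add: ennreal_eq_0_iff)
  next
    assume "B = 0"
    then have "(\<integral>\<^sup>+ x. ennreal (b x powr q) \<partial>M) = 0" using B by simp
    then have "AE x in M. ennreal (b x powr q) = 0" by (subst (asm) nn_integral_0_iff_AE) auto
    then show ?thesis by eventually_elim (simp add: ennreal_eq_0_iff)
  qed
  then have "AE x in M. ennreal (a x * b x) = 0" by eventually_elim (simp only: ennreal_0)
  then have "(\<integral>\<^sup>+ x. ennreal (a x * b x) \<partial>M) = 0" by (subst nn_integral_0_iff_AE) auto
  then show ?thesis by simp
next
  case False
  then have pos: "0 < A" "0 < B" using nonneg by auto
  define al where "al = A powr (1 / p)"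
  define be where "be = B powr (1 / q)"
  have albe: "0 < al" "0 < be" "al powr p = A" "be powr q = B"
    using pos pq by (auto simp: al_def be_def powr_powr)
  have young: "a x * b x \<le> al * be / (A * p) * a x powr p + al * be / (B * q) * b x powr q" for x
  proof -
    have "a x / al * (b x / be) \<le> (a x / al) powr p / p + (b x / be) powr q / q"
      using pq nonneg albe by (intro Youngs_inequality) auto
    also have "(a x / al) powr p = a x powr p / A" using albe nonneg by (simp add: powr_divide)
    also have "(b x / be) powr q = b x powr q / B" using albe nonneg by (simp add: powr_divide)
    finally have "al * be * (a x / al * (b x / be)) \<le> al * be * (a x powr p / A / p + b x powr q / B / q)"
      using albe by (intro mult_left_mono) auto
    then show ?thesis using albe by (simp add: field_simps)
  qed
  have "(\<integral>\<^sup>+ x. ennreal (a x * b x) \<partial>M)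
      \<le> (\<integral>\<^sup>+ x. ennreal (al * be / (A * p)) * ennreal (a x powr p)
          + ennreal (al * be / (B * q)) * ennreal (b x powr q) \<partial>M)"
    using albe pos pq young by (intro nn_integral_mono)
      (auto simp: ennreal_mult'[symmetric] ennreal_plus[symmetric] intro!: ennreal_leI simp del: ennreal_plus)
  also have "\<dots> = ennreal (al * be / (A * p)) * (\<integral>\<^sup>+ x. ennreal (a x powr p) \<partial>M)
      + ennreal (al * be / (B * q)) * (\<integral>\<^sup>+ x. ennreal (b x powr q) \<partial>M)"
    by (subst nn_integral_add) (auto simp: nn_integral_cmult)
  also have "\<dots> \<le> ennreal (al * be / (A * p)) * ennreal A + ennreal (al * be / (B * q)) * ennreal B"
    by (intro add_mono mult_left_mono A B) auto
  also have "\<dots> = ennreal (al * be / (A * p) * A + al * be / (B * q) * B)"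
    using albe pos pq by (simp add: ennreal_mult'[symmetric] ennreal_plus[symmetric] del: ennreal_plus)
  also have "al * be / (A * p) * A + al * be / (B * q) * B = al * be * (1 / p + 1 / q)"
    using pos by (simp add: field_simps)
  finally show ?thesis using pq by (simp add: al_def be_def)
qed

text \<open>The infimum runs over \<open>s < t\<close> only; continuity of \<open>I\<close> covers the case \<open>r = t\<close>.\<close>

lemma w_fun_1_mult_le:
  assumes cont: "continuous_on {0..1} I" and nonneg: "\<forall>s\<in>{0..1}. 0 \<le> I s"
    and t: "0 < t" "t < 1" and r: "0 \<le> r" "r \<le> t"
  shows "w_fun I 1 t * r \<le> I r" "0 \<le> w_fun I 1 t"
proof -
  let ?w = "w_fun I 1 t"
  have w: "?w = (INF s\<in>{0<..<t}. I s / s)" by (simp add: w_fun_def)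
  have bdd: "bdd_below ((\<lambda>s. I s / s) ` {0<..<t})"
    using nonneg t by (intro bdd_belowI[of _ 0]) auto
  show "0 \<le> ?w" unfolding w using nonneg t by (intro cINF_greatest) auto
  have less: "?w * s \<le> I s" if "0 < s" "s < t" for s
  proof -
    have "?w \<le> I s / s" unfolding w using that bdd by (intro cINF_lower) auto
    then show ?thesis using that by (simp add: pos_le_divide_eq)
  qed
  consider "r = 0" | "0 < r" "r < t" | "r = t" using r by linarith
  then show "?w * r \<le> I r"
  proof cases
    case 1 then show ?thesis using nonneg by simp
  next
    case 2 then show ?thesis by (rule less)
  next
    case 3
    have "isCont I t" using cont t by (intro continuous_on_interior[of "{0..1}"]) auto
    then have "isCont (\<lambda>s. I s - ?w * s) t" by (intro continuous_intros)
    then have "((\<lambda>s. I s - ?w * s) \<longlongrightarrow> I t - ?w * t) (at_left t)"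
      unfolding isCont_def by (rule filterlim_mono) (auto simp: at_le)
    moreover have "eventually (\<lambda>s. 0 \<le> I s - ?w * s) (at_left t)"
      using eventually_at_left_real[OF t(1)] by eventually_elim (use less in auto)
    ultimately have "0 \<le> I t - ?w * t" by (rule tendsto_lowerbound) simp
    then show ?thesis using 3 by simp
  qed
qed

text \<open>The case \<open>q = 1\<close>: the coarea inequality is tested with the indicator of the levels above \<open>f\<^sup>*(t)\<close>.\<close>

lemma oscillation_w_fun_1:
  fixes M :: "'a::metric_space measure"
  assumes prob: "prob_space M" and sets: "sets M = sets borel"
    and prof: "isoperimetric_minorant M I" and cont: "continuous_on {0..1} I"
    and lip: "L-lipschitz_on UNIV f" and f: "integrable M f" and t: "0 < t" "t < 1"
  shows "t * (max_rearr M f t - decr_rearr M f t) * w_fun I 1 t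
    \<le> (LINT s:{0<..<t}|lborel. decr_rearr M (grad_norm f) s powr 1)" (is "?X * ?w \<le> ?R")
proof -
  interpret prob_space M by fact
  let ?c = "decr_rearr M f t"
  have fm[measurable]: "f \<in> borel_measurable M" using f by auto
  have gm[measurable]: "grad_norm f \<in> borel_measurable M"
    using borel_measurable_grad_norm[OF lip] measurable_cong_sets[OF sets refl] by blast
  note [measurable] = borel_measurable_distribution_fun[OF fm]
  have I: "\<forall>s\<in>{0..1}. 0 \<le> I s"
    using prof by (auto simp: isoperimetric_minorant_def)
  note w = w_fun_1_mult_le[OF cont I t]
  have w0: "0 \<le> ?w" using w(2)[of 0] t by simp
  have D: "distribution_fun M f l \<le> t" if "?c \<le> l" for l
    using distribution_fun_antimono[OF fm that] distribution_fun_decr_rearr_le[OF fm t(1)] by simp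
  have "ennreal (?X * ?w) = ennreal ?w * (\<integral>\<^sup>+ l\<in>{?c<..}. ennreal (distribution_fun M f l) \<partial>lborel)"
    using w0 by (simp add: max_rearr_minus_decr_rearr[OF f t, symmetric] ennreal_mult'[symmetric] mult.commute)
  also have "\<dots> = (\<integral>\<^sup>+ l. ennreal ?w * (ennreal (distribution_fun M f l) * indicator {?c<..} l) \<partial>lborel)"
    by (intro nn_integral_cmult[symmetric]) measurable
  also have "\<dots> \<le> (\<integral>\<^sup>+ l. indicator {?c<..} l * ennreal (I (distribution_fun M f l)) \<partial>lborel)"
    using w0 w(1)[OF _ D] distribution_fun_bounds(1)[of f]
    by (intro nn_integral_mono) (auto simp: ennreal_mult'[symmetric] intro!: ennreal_leI split: split_indicator)
  also have "\<dots> \<le> (\<integral>\<^sup>+ x. indicator {?c<..} \<bar>f x\<bar> * ennreal (grad_norm f x) \<partial>M)"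
    by (rule coarea_distribution_fun_le[OF prob sets prof cont lip]) measurable
  also have "\<dots> = (\<integral>\<^sup>+ x\<in>{x\<in>space M. ?c < \<bar>f x\<bar>}. ennreal (\<bar>grad_norm f x\<bar> powr 1) \<partial>M)"
    using grad_norm_nonneg[of f] by (intro nn_integral_cong) (auto split: split_indicator)
  also have "\<dots> \<le> ennreal ?R"
    using grad_norm_nonneg[of f] grad_norm_le_Lipschitz[OF lip] D[of ?c] t
    by (intro nn_integral_powr_le_decr_rearr[of _ L] gm) (auto simp: distribution_fun_def)
  finally show ?thesis
    by (subst (asm) ennreal_le_iff) (auto simp: set_lebesgue_integral_def intro!: integral_nonneg_AE)
qed

text \<open>The case \<open>q > 1\<close> with a finite integral in the weight: the coarea inequality is tested with \<open>\<mu>\<^sub>f / I(\<mu>\<^sub>f)\<close> off the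
  levels of positive mass, and Hoelder's inequality is applied on the space.\<close>

lemma oscillation_Holder:
  fixes M :: "'a::metric_space measure"
  assumes prob: "prob_space M" and sets: "sets M = sets borel"
    and prof: "isoperimetric_minorant M I" and cont: "continuous_on {0..1} I"
    and pos: "\<And>s. s \<in> {0<..<1} \<Longrightarrow> 0 < I s"
    and lip: "L-lipschitz_on UNIV f" and f: "integrable M f" and t: "0 < t" "t < 1"
    and pq: "1 < p" "1 < q" "1 / p + 1 / q = 1"
    and A: "(\<integral>\<^sup>+ s\<in>{0<..<t}. ennreal ((s / I s) powr p) \<partial>lborel) = ennreal A" "0 \<le> A"
  shows "t * (max_rearr M f t - decr_rearr M f t)
    \<le> A powr (1 / p) * (LINT s:{0<..<t}|lborel. decr_rearr M (grad_norm f) s powr q) powr (1 / q)"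
    (is "?X \<le> A powr (1 / p) * ?R powr (1 / q)")
proof -
  interpret prob_space M by fact
  let ?c = "decr_rearr M f t"
  have fm[measurable]: "f \<in> borel_measurable M" using f by auto
  have gm[measurable]: "grad_norm f \<in> borel_measurable M"
    using borel_measurable_grad_norm[OF lip] measurable_cong_sets[OF sets refl] by blast
  \<comment> \<open>Nothing is known about \<open>I\<close> outside \<open>[0, 1]\<close>; cutting it off makes it Borel on the whole line.\<close>
  define J where "J s = indicator {0..1} s *\<^sub>R I s" for s
  have [measurable]: "J \<in> borel_measurable borel"
    unfolding J_def[abs_def] using cont by (intro borel_measurable_continuous_on_indicator) auto
  note [measurable] = borel_measurable_distribution_fun[OF fm]
  have at_meas[measurable]: "level_atoms M f \<in> sets borel"
    using countable_level_atoms[OF fm] by (rule sets.countable[rotated]) simp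
  have J: "J s = I s" if "0 < s" "s < 1" for s using that by (simp add: J_def)
  have J0: "0 \<le> J s" for s
    using prof by (auto simp: J_def isoperimetric_minorant_def split: split_indicator)
  define S where "S = {?c<..} - level_atoms M f"
  have [measurable]: "S \<in> sets borel" unfolding S_def by measurable
  define w where "w l = distribution_fun M f l / J (distribution_fun M f l) * indicator S l" for l
  have [measurable]: "w \<in> borel_measurable borel" unfolding w_def by measurable
  have w0: "0 \<le> w l" for l using J0 distribution_fun_bounds(1) by (simp add: w_def)
  have D: "distribution_fun M f l \<le> t" if "?c \<le> l" for l
    using distribution_fun_antimono[OF fm that] distribution_fun_decr_rearr_le[OF fm t(1)] by simp
  have R0: "0 \<le> ?R" by (auto simp: set_lebesgue_integral_def intro!: integral_nonneg_AE)
  have "level_atoms M f \<in> null_sets lborel"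
    using countable_level_atoms[OF fm] by (intro countable_imp_null_set_lborel)
  then have ae: "AE l in lborel. l \<notin> level_atoms M f" by (rule AE_not_in)
  have "ennreal ?X = (\<integral>\<^sup>+ l\<in>{?c<..}. ennreal (distribution_fun M f l) \<partial>lborel)"
    by (rule max_rearr_minus_decr_rearr[OF f t])
  also have "\<dots> \<le> (\<integral>\<^sup>+ l. ennreal (w l) * ennreal (I (distribution_fun M f l)) \<partial>lborel)"
  proof (intro nn_integral_mono_AE, use ae in eventually_elim)
    fix l assume l: "l \<notin> level_atoms M f"
    show "ennreal (distribution_fun M f l) * indicator {?c<..} l \<le> ennreal (w l) * ennreal (I (distribution_fun M f l))"
    proof (cases "?c < l \<and> 0 < distribution_fun M f l")
      case True
      then have d: "0 < distribution_fun M f l" "distribution_fun M f l < 1" using D[of l] t by auto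
      have "w l * I (distribution_fun M f l) = distribution_fun M f l"
        using True l pos[of "distribution_fun M f l"] d by (simp add: w_def S_def J)
      then show ?thesis using True w0[of l] by (simp add: ennreal_mult'[symmetric])
    next
      case False
      then show ?thesis using distribution_fun_bounds(1)[of f l] by (auto split: split_indicator simp: ennreal_neg)
    qed
  qed
  also have "\<dots> \<le> (\<integral>\<^sup>+ x. ennreal (w \<bar>f x\<bar>) * ennreal (grad_norm f x) \<partial>M)"
    by (rule coarea_distribution_fun_le[OF prob sets prof cont lip]) measurable
  also have "\<dots> = (\<integral>\<^sup>+ x. ennreal (w \<bar>f x\<bar> * (grad_norm f x * indicator {x\<in>space M. ?c < \<bar>f x\<bar>} x)) \<partial>M)"
    using w0 by (intro nn_integral_cong)
      (auto simp: ennreal_mult'[symmetric] w_def S_def split: split_indicator)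
  also have "\<dots> \<le> ennreal (A powr (1 / p) * ?R powr (1 / q))"
  proof (rule nn_integral_Holder[OF pq])
    have "(\<integral>\<^sup>+ x. ennreal (w \<bar>f x\<bar> powr p) \<partial>M)
      = (\<integral>\<^sup>+ x. ennreal ((distribution_fun M f \<bar>f x\<bar> / J (distribution_fun M f \<bar>f x\<bar>)) powr p)
          * indicator ({?c<..} - level_atoms M f) \<bar>f x\<bar> \<partial>M)"
      using pq by (intro nn_integral_cong) (auto simp: w_def S_def split: split_indicator)
    also have "\<dots> \<le> (\<integral>\<^sup>+ s\<in>{0<..<t}. ennreal ((s / J s) powr p) \<partial>lborel)"
      by (intro nn_integral_distribution_fun_levels_le fm t) measurable
    also have "\<dots> = (\<integral>\<^sup>+ s\<in>{0<..<t}. ennreal ((s / I s) powr p) \<partial>lborel)"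
      using t J by (intro nn_integral_cong) (auto split: split_indicator)
    finally show "(\<integral>\<^sup>+ x. ennreal (w \<bar>f x\<bar> powr p) \<partial>M) \<le> ennreal A" using A by simp
    have "(\<integral>\<^sup>+ x. ennreal ((grad_norm f x * indicator {x\<in>space M. ?c < \<bar>f x\<bar>} x) powr q) \<partial>M)
      = (\<integral>\<^sup>+ x\<in>{x\<in>space M. ?c < \<bar>f x\<bar>}. ennreal (\<bar>grad_norm f x\<bar> powr q) \<partial>M)"
      using grad_norm_nonneg[of f] pq by (intro nn_integral_cong) (auto split: split_indicator)
    also have "\<dots> \<le> ennreal ?R"
      using grad_norm_nonneg[of f] grad_norm_le_Lipschitz[OF lip] D[of ?c] t pq
      by (intro nn_integral_powr_le_decr_rearr[of _ L] gm) (auto simp: distribution_fun_def)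
    finally show "(\<integral>\<^sup>+ x. ennreal ((grad_norm f x * indicator {x\<in>space M. ?c < \<bar>f x\<bar>} x) powr q) \<partial>M) \<le> ennreal ?R" .
    show "(\<lambda>x. w \<bar>f x\<bar>) \<in> borel_measurable M" by measurable
    show "(\<lambda>x. grad_norm f x * indicator {x\<in>space M. ?c < \<bar>f x\<bar>} x) \<in> borel_measurable M"
      by measurable
    show "0 \<le> grad_norm f x * indicator {x\<in>space M. ?c < \<bar>f x\<bar>} x" for x
      using grad_norm_nonneg[of f x] by simp
  qed (fact w0 A(2) R0)+
  finally show ?thesis by (subst (asm) ennreal_le_iff) auto
qed

theorem theorem2:
  fixes M :: "'a::metric_space measure"
    and I :: "real \<Rightarrow> real"
    and q :: real
    and f :: "'a \<Rightarrow> real"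
    and t :: real
  assumes "metric_probability_space M"
    and "is_isoperimetric_profile M I"
    and "continuous_on {0..1} I"
    and "\<And>s. s \<in> {0<..<1} \<Longrightarrow> 0 < I s"
    and "I 0 = 0"
    and "1 \<le> q"
    and "f \<in> Lip"
    and "integrable M f"
    and "t \<in> {0<..<1}"
  shows "(max_rearr M f t - decr_rearr M f t) * w_fun I q t
       \<le> (1 / t * (LINT s:{0<..<t}|lborel. (decr_rearr M (grad_norm f) s) powr q)) powr (1 / q)"
proof -
  interpret metric_probability_space M by fact
  have prob: "prob_space M" by unfold_locales
  have prof: "isoperimetric_minorant M I" using assms(2) by (simp add: is_isoperimetric_profile_def)
  obtain L where lip: "L-lipschitz_on UNIV f" using assms(7) by (auto simp: Lip_def)
  have t: "0 < t" "t < 1" using assms(9) by auto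
  let ?X = "max_rearr M f t - decr_rearr M f t"
  let ?R = "LINT s:{0<..<t}|lborel. (decr_rearr M (grad_norm f) s) powr q"
  have R0: "0 \<le> ?R" by (auto simp: set_lebesgue_integral_def intro!: integral_nonneg_AE)
  show ?thesis
  proof (cases "q = 1")
    case True
    have "t * ?X * w_fun I q t \<le> ?R"
      unfolding True by (rule oscillation_w_fun_1[OF prob sets_eq_borel prof assms(3) lip assms(8) t])
    then have "?X * w_fun I q t \<le> 1 / t * ?R" using t by (simp add: field_simps)
    then show ?thesis using True R0 t by simp
  next
    case False
    then have q: "1 < q" using assms(6) by simp
    define p where "p = q / (q - 1)"
    have p: "1 < p" "1 / p + 1 / q = 1" using q by (auto simp: p_def field_simps)
    have expo: "(1 - q) / q = - (1 / p)" using q by (simp add: p_def field_simps)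
    define J where "J = (\<integral>\<^sup>+ s\<in>{0<..<t}. ennreal ((s / I s) powr p) \<partial>lborel)"
    define A where "A = enn2real J"
    have w: "w_fun I q t = (if J = \<infinity> then 0 else (1 / t * A) powr (- (1 / p)))"
      using False by (simp add: w_fun_def J_def A_def p_def expo[unfolded p_def] Let_def)
    show ?thesis
    proof (cases "J = \<infinity> \<or> A = 0")
      case True
      then show ?thesis by (auto simp: w)
    next
      case fin: False
      then have JA: "J = ennreal A" "0 < A" by (auto simp: A_def less_top enn2real_nonneg order.not_eq_order_implies_strict)
      have "t * ?X \<le> A powr (1 / p) * ?R powr (1 / q)"
        using JA by (intro oscillation_Holder[OF prob sets_eq_borel prof assms(3,4) lip assms(8) t p(1) q p(2)])
          (auto simp: J_def)
      then have X: "?X \<le> A powr (1 / p) * ?R powr (1 / q) / t" using t by (simp add: field_simps)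
      have weq: "w_fun I q t = t powr (1 / p) / A powr (1 / p)"
        using fin JA t by (simp add: w powr_mult powr_minus powr_divide divide_simps)
      have "?X * w_fun I q t \<le> A powr (1 / p) * ?R powr (1 / q) / t * (t powr (1 / p) / A powr (1 / p))"
        unfolding weq using X by (rule mult_right_mono) simp
      also have "A powr (1 / p) * ?R powr (1 / q) / t * (t powr (1 / p) / A powr (1 / p)) = t powr (1 / p) / t * ?R powr (1 / q)"
        using JA by simp
      also have "t powr (1 / p) / t = (1 / t) powr (1 / q)"
      proof -
        have "t powr (1 / p) / t = t powr (1 / p - 1)" using t by (simp add: powr_diff)
        also have "1 / p - 1 = - (1 / q)" using p by simp
        finally show ?thesis using t by (simp add: powr_minus powr_divide divide_simps)
      qed
      also have "(1 / t) powr (1 / q) * ?R powr (1 / q) = (1 / t * ?R) powr (1 / q)"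
        using t R0 by (subst powr_mult) auto
      finally show ?thesis .
    qed
  qed
qed

end
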